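(* Suppose that either $(G,d(\cdot))$ is piecewise $\mathcal C^1$ with continuous reflection and $G$ is bounded, or $(G,d(\cdot))$ is polyhedral with piecewise constant reflection. If $\mathcal V\subset\partial G$ satisfies Assumption 2' and the drift and dispersion coefficients $b(\cdot)$ and $\sigma(\cdot)$ are continuous and uniformly bounded, then Assumption TF and Assumption V (stated in the context) are satisfied.
   Context: Notation: $\langle\cdot,\cdot\rangle$, $|\cdot|$ Euclidean; $B_r(x)=\{y\in\mathbb R^J:|y-x|\le r\}$, $\mathrm{dist}(y,A)=\inf_{z\in A}|y-z|$. $b:\mathbb R^J\to\mathbb R^J$, $\sigma:\mathbb R^J\to\mathbb R^{J\times N}$, $a=\sigma\sigma^T$, $\mathcal Lf=\sum_i b_i\partial_{x_i}f+\frac12\sum_{i,j}a_{ij}\partial^2_{x_ix_j}f$. Piecewise $\mathcal C^1$ with continuous reflection: $G=\bigcap_{i\in\mathcal I}G_i$ is a nonempty domain, $\mathcal I$ finite, each $G_i=\{x:\phi^i(x)>0\}$ with $\partial G_i=\{x:\phi^i(x)=0\}$ for some continuously differentiable $\phi^i$ on $\mathbb R^J$; $n^i(x)$ is the unit inward normal to $\partial G_i$ at $x\in\partial G_i$; $\mathcal I(x)=\{i\in\mathcal I:x\in\partial G_i\}$; $n(x)=\{\sum_{i\in\mathcal I(x)}s_in^i(x):s_i\ge0\}$ for $x\in\partial G$; for each $i$, $\gamma^i(\cdot)$ is a continuous vector field on $\partial G_i$ with $\langle n^i(x),\gamma^i(x)\rangle>0$, and $d(x)=\{\sum_{i\in\mathcal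 I(x)}s_i\gamma^i(x):s_i\ge0\}$ for $x\in\partial G$, $d(x)=\{0\}$ for $x\in G$. Polyhedral with piecewise constant reflection: additionally all $n^i(\cdot)$ and $\gamma^i(\cdot)$ are constant. $\mathcal U=\{x\in\partial G:\exists n\in n(x)\text{ with }\langle n,d\rangle>0\ \forall d\in d(x)\setminus\{0\}\}$. Assumption 2': $\mathcal V$ is a finite set with $\mathcal V\supset\partial G\setminus\mathcal U$, and for each $x\in\mathcal V$ there exist a unit vector $v_x$ and constants $r_x>0$, $\alpha_x>0$, $0<c^1_x<1<c^2_x<\infty$ such that, with $\Theta_x=\{z:\langle z,v_x\rangle\ge0\}$, for all $y\in\overline G\cap B_{r_x}(x)$: (1) $\langle v_x,y-x\rangle\ge\alpha_x|y-x|$; (2) $\gamma^i(y)\in\Theta_x$ for each $i\in\mathcal I(y)\subset\mathcal I(x)$; (3) for every $r\in(0,r_x/c^2_x)$, $\overline G\cap B_{c^1_xr}(x)\subseteq\{y\in\overline G\cap B_{r_x}(x):\mathrm{dist}(y,x+rv_x+\Theta_x)>0\}\subseteq\overline G\cap B_{c^2_xr}(x)$; (4) $v_x^Ta(y)v_x\ge\alpha_x$ for all $y\in B_{r_x}(x)$. Function spaces: $\mathcal C^2(\overline G)$ are restrictions to $\overline G$ of functions $\mathcal C^2$ on every open neighbourhood of $\overline G$; subscripts $b$, $c$ mean bounded with bounded derivatives up to order 2, resp. compact support; $\mathcal C^2_c(\overline G)\oplus\mathbb R$ are sums of a $\mathcal C^2_c(\overline G)$ function and a constant. $f$ is constant in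 a neighbourhood of $\mathcal V$ if it is constant near each point of $\mathcal V$. $\mathcal H=\{f\in\mathcal C^2_c(\overline G)\oplus\mathbb R: f\text{ constant in a neighbourhood of }\mathcal V,\ \langle d,\nabla f(y)\rangle\le0\ \forall d\in d(y),y\in\partial G\}$. Assumption TF: for each $\varepsilon>0$, $N\in\mathbb N$ there exist nonnegative $\{f_{x,\varepsilon}\in\mathcal C^2_b(\overline G):x\in\overline G\cap B_N(0)\}$ and constants $C(N,\varepsilon),c(N,\varepsilon)>0$ with: (1) each $f_{x,\varepsilon}$ is a finite or countable sum of functions in $\mathcal H\cap\mathcal C^2_c(\overline G)$; (2) $f_{x,\varepsilon}(y)=0$ if $|y-x|\le\varepsilon/2$ and $f_{x,\varepsilon}(y)>c(N,\varepsilon)$ if $|y-x|>3\varepsilon$, $y\in\overline G$; (3) $|\mathcal Lf_{x,\varepsilon}(y)|\le C(N,\varepsilon)$ for all $y\in\overline G$. Assumption V: $\mathcal V$ is finite and for each $x\in\mathcal V$ there exist a unit vector $v_x$ and $\alpha_x,r_x>0$ with $\langle v_x,y-x\rangle\ge\alpha_x|y-x|$, $v_x^Ta(y)v_x\ge\alpha_x$ and $\langle v_x,d\rangle\ge0$ for all $d\in d(y)$, $y\in\overline G\cap B_{r_x}(x)$. *)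

theory Defs
  imports "HOL-Analysis.Analysis"
begin

definition pd :: "'J::finite \<Rightarrow> (real^'J \<Rightarrow> real) \<Rightarrow> real^'J \<Rightarrow> real" where
  "pd i f x = frechet_derivative f (at x) (axis i 1)"

definition grad :: "(real^'J::finite \<Rightarrow> real) \<Rightarrow> real^'J \<Rightarrow> real^'J" where
  "grad f x = (\<chi> i. pd i f x)"

definition C1_fun :: "(real^'J::finite \<Rightarrow> real) \<Rightarrow> bool" where
  "C1_fun f \<longleftrightarrow> (\<forall>x. f differentiable (at x)) \<and> (\<forall>k. continuous_on UNIV (pd k f))"

definition C2_on :: "(real^'J::finite) set \<Rightarrow> (real^'J \<Rightarrow> real) \<Rightarrow> bool" where
  "C2_on U f \<longleftrightarrow> open U \<and> (\<forall>x\<in>U. f differentiable (at x))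
     \<and> (\<forall>j. \<forall>x\<in>U. pd j f differentiable (at x))
     \<and> (\<forall>i j. continuous_on U (pd i (pd j f)))"

definition C2_near :: "(real^'J::finite) set \<Rightarrow> (real^'J \<Rightarrow> real) \<Rightarrow> bool" where
  "C2_near S f \<longleftrightarrow> (\<exists>U. S \<subseteq> U \<and> C2_on U f)"

definition C2b :: "(real^'J::finite) set \<Rightarrow> (real^'J \<Rightarrow> real) \<Rightarrow> bool" where
  "C2b S f \<longleftrightarrow> C2_near S f \<and> bounded (f ` S) \<and> (\<forall>i. bounded (pd i f ` S))
     \<and> (\<forall>i j. bounded (pd i (pd j f) ` S))"

definition C2c :: "(real^'J::finite) set \<Rightarrow> (real^'J \<Rightarrow> real) \<Rightarrow> bool" where
  "C2c S f \<longleftrightarrow> C2_near S f \<and> bounded {y\<in>S. f y \<noteq> 0}"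

definition C2c_plus :: "(real^'J::finite) set \<Rightarrow> (real^'J \<Rightarrow> real) \<Rightarrow> bool" where
  "C2c_plus S f \<longleftrightarrow> (\<exists>g c. C2c S g \<and> f = (\<lambda>y. g y + c))"

definition amat :: "(real^'J::finite \<Rightarrow> real^'N::finite^'J) \<Rightarrow> real^'J \<Rightarrow> real^'J^'J" where
  "amat \<sigma> y = \<sigma> y ** transpose (\<sigma> y)"

definition Lgen :: "(real^'J::finite \<Rightarrow> real^'J) \<Rightarrow> (real^'J \<Rightarrow> real^'N::finite^'J)
     \<Rightarrow> (real^'J \<Rightarrow> real) \<Rightarrow> real^'J \<Rightarrow> real" where
  "Lgen b \<sigma> f y = (\<Sum>i\<in>UNIV. b y $ i * pd i f y)
      + 1/2 * (\<Sum>i\<in>UNIV. \<Sum>j\<in>UNIV. amat \<sigma> y $ i $ j * pd i (pd j f) y)"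

definition Gi :: "('i \<Rightarrow> real^'J::finite \<Rightarrow> real) \<Rightarrow> 'i \<Rightarrow> (real^'J) set" where
  "Gi \<phi> i = {x. \<phi> i x > 0}"

definition GG :: "'i set \<Rightarrow> ('i \<Rightarrow> real^'J::finite \<Rightarrow> real) \<Rightarrow> (real^'J) set" where
  "GG I \<phi> = (\<Inter>i\<in>I. Gi \<phi> i)"

text \<open>Unit inward normal to the boundary of G_i = {phi_i > 0}.\<close>
definition nrm :: "('i \<Rightarrow> real^'J::finite \<Rightarrow> real) \<Rightarrow> 'i \<Rightarrow> real^'J \<Rightarrow> real^'J" where
  "nrm \<phi> i x = (1 / norm (grad (\<phi> i) x)) *\<^sub>R grad (\<phi> i) x"

definition Idx :: "'i set \<Rightarrow> ('i \<Rightarrow> real^'J::finite \<Rightarrow> real) \<Rightarrow> real^'J \<Rightarrow> 'i set" where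
  "Idx I \<phi> x = {i\<in>I. x \<in> frontier (Gi \<phi> i)}"

definition ncone :: "'i set \<Rightarrow> ('i \<Rightarrow> real^'J::finite \<Rightarrow> real) \<Rightarrow> real^'J \<Rightarrow> (real^'J) set" where
  "ncone I \<phi> x = {(\<Sum>i\<in>Idx I \<phi> x. s i *\<^sub>R nrm \<phi> i x) | s. \<forall>i\<in>Idx I \<phi> x. 0 \<le> s i}"

definition dcone :: "'i set \<Rightarrow> ('i \<Rightarrow> real^'J::finite \<Rightarrow> real) \<Rightarrow> ('i \<Rightarrow> real^'J \<Rightarrow> real^'J)
     \<Rightarrow> real^'J \<Rightarrow> (real^'J) set" where
  "dcone I \<phi> \<gamma> x = (if x \<in> frontier (GG I \<phi>)
      then {(\<Sum>i\<in>Idx I \<phi> x. s i *\<^sub>R \<gamma> i x) | s. \<forall>i\<in>Idx I \<phi> x. 0 \<le> s i}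
      else {0})"

definition Uset :: "'i set \<Rightarrow> ('i \<Rightarrow> real^'J::finite \<Rightarrow> real) \<Rightarrow> ('i \<Rightarrow> real^'J \<Rightarrow> real^'J)
     \<Rightarrow> (real^'J) set" where
  "Uset I \<phi> \<gamma> = {x\<in>frontier (GG I \<phi>). \<exists>n\<in>ncone I \<phi> x.
      \<forall>d\<in>dcone I \<phi> \<gamma> x - {0}. inner n d > 0}"

definition pw_C1_refl :: "'i set \<Rightarrow> ('i \<Rightarrow> real^'J::finite \<Rightarrow> real) \<Rightarrow> ('i \<Rightarrow> real^'J \<Rightarrow> real^'J) \<Rightarrow> bool" where
  "pw_C1_refl I \<phi> \<gamma> \<longleftrightarrow> finite I \<and> GG I \<phi> \<noteq> {} \<and> open (GG I \<phi>) \<and> connected (GG I \<phi>)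
     \<and> (\<forall>i\<in>I. C1_fun (\<phi> i)
          \<and> frontier (Gi \<phi> i) = {x. \<phi> i x = 0}
          \<and> (\<forall>x\<in>frontier (Gi \<phi> i). grad (\<phi> i) x \<noteq> 0)
          \<and> continuous_on (frontier (Gi \<phi> i)) (\<gamma> i)
          \<and> (\<forall>x\<in>frontier (Gi \<phi> i). inner (nrm \<phi> i x) (\<gamma> i x) > 0))"

definition polyhedral_refl :: "'i set \<Rightarrow> ('i \<Rightarrow> real^'J::finite \<Rightarrow> real) \<Rightarrow> ('i \<Rightarrow> real^'J \<Rightarrow> real^'J) \<Rightarrow> bool" where
  "polyhedral_refl I \<phi> \<gamma> \<longleftrightarrow> pw_C1_refl I \<phi> \<gamma>
     \<and> (\<forall>i\<in>I. (\<exists>\<nu>. \<forall>x\<in>frontier (Gi \<phi> i). nrm \<phi> i x = \<nu>)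
             \<and> (\<exists>g. \<forall>x\<in>frontier (Gi \<phi> i). \<gamma> i x = g))"

definition Assumption2' :: "'i set \<Rightarrow> ('i \<Rightarrow> real^'J::finite \<Rightarrow> real) \<Rightarrow> ('i \<Rightarrow> real^'J \<Rightarrow> real^'J)
     \<Rightarrow> (real^'J \<Rightarrow> real^'N::finite^'J) \<Rightarrow> (real^'J) set \<Rightarrow> bool" where
  "Assumption2' I \<phi> \<gamma> \<sigma> V \<longleftrightarrow> finite V \<and> frontier (GG I \<phi>) - Uset I \<phi> \<gamma> \<subseteq> V \<and>
    (\<forall>x\<in>V. \<exists>v r \<alpha> c1 c2. norm v = 1 \<and> r > 0 \<and> \<alpha> > 0 \<and> 0 < c1 \<and> c1 < 1 \<and> 1 < c2 \<and>
       (\<forall>y\<in>closure (GG I \<phi>) \<inter> cball x r.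
           inner v (y - x) \<ge> \<alpha> * norm (y - x)
         \<and> Idx I \<phi> y \<subseteq> Idx I \<phi> x
         \<and> (\<forall>i\<in>Idx I \<phi> y. inner (\<gamma> i y) v \<ge> 0)) \<and>
       (\<forall>\<rho>. 0 < \<rho> \<and> \<rho> < r / c2 \<longrightarrow>
           closure (GG I \<phi>) \<inter> cball x (c1 * \<rho>)
             \<subseteq> {y\<in>closure (GG I \<phi>) \<inter> cball x r.
                   infdist y ((+) (x + \<rho> *\<^sub>R v) ` {z. inner z v \<ge> 0}) > 0}
         \<and> {y\<in>closure (GG I \<phi>) \<inter> cball x r.
                   infdist y ((+) (x + \<rho> *\<^sub>R v) ` {z. inner z v \<ge> 0}) > 0}
             \<subseteq> closure (GG I \<phi>) \<inter> cball x (c2 * \<rho>)) \<and>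
       (\<forall>y\<in>cball x r. inner v (amat \<sigma> y *v v) \<ge> \<alpha>))"

definition Hset :: "'i set \<Rightarrow> ('i \<Rightarrow> real^'J::finite \<Rightarrow> real) \<Rightarrow> ('i \<Rightarrow> real^'J \<Rightarrow> real^'J)
     \<Rightarrow> (real^'J) set \<Rightarrow> (real^'J \<Rightarrow> real) set" where
  "Hset I \<phi> \<gamma> V = {f. C2c_plus (closure (GG I \<phi>)) f
      \<and> (\<forall>x\<in>V. \<exists>\<delta>>0. \<exists>k. \<forall>y\<in>closure (GG I \<phi>) \<inter> ball x \<delta>. f y = k)
      \<and> (\<forall>y\<in>frontier (GG I \<phi>). \<forall>d\<in>dcone I \<phi> \<gamma> y. inner d (grad f y) \<le> 0)}"

definition AssumptionTF :: "(real^'J::finite \<Rightarrow> real^'J) \<Rightarrow> (real^'J \<Rightarrow> real^'N::finite^'J)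
     \<Rightarrow> 'i set \<Rightarrow> ('i \<Rightarrow> real^'J \<Rightarrow> real) \<Rightarrow> ('i \<Rightarrow> real^'J \<Rightarrow> real^'J) \<Rightarrow> (real^'J) set \<Rightarrow> bool" where
  "AssumptionTF b \<sigma> I \<phi> \<gamma> V \<longleftrightarrow>
    (\<forall>\<epsilon>>0. \<forall>N::nat. \<exists>(f :: real^'J \<Rightarrow> real^'J \<Rightarrow> real) C c. C > 0 \<and> c > 0 \<and>
      (\<forall>x\<in>closure (GG I \<phi>) \<inter> cball 0 (real N).
          C2b (closure (GG I \<phi>)) (f x)
        \<and> (\<forall>y\<in>closure (GG I \<phi>). f x y \<ge> 0)
        \<and> (\<exists>h :: nat \<Rightarrow> real^'J \<Rightarrow> real.
              (\<forall>k. h k \<in> Hset I \<phi> \<gamma> V \<and> C2c (closure (GG I \<phi>)) (h k))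
            \<and> (\<forall>y\<in>closure (GG I \<phi>). (\<lambda>k. h k y) sums f x y))
        \<and> (\<forall>y\<in>closure (GG I \<phi>). norm (y - x) \<le> \<epsilon> / 2 \<longrightarrow> f x y = 0)
        \<and> (\<forall>y\<in>closure (GG I \<phi>). norm (y - x) > 3 * \<epsilon> \<longrightarrow> f x y > c)
        \<and> (\<forall>y\<in>closure (GG I \<phi>). \<bar>Lgen b \<sigma> (f x) y\<bar> \<le> C)))"

definition AssumptionV :: "(real^'J::finite \<Rightarrow> real^'N::finite^'J)
     \<Rightarrow> 'i set \<Rightarrow> ('i \<Rightarrow> real^'J \<Rightarrow> real) \<Rightarrow> ('i \<Rightarrow> real^'J \<Rightarrow> real^'J) \<Rightarrow> (real^'J) set \<Rightarrow> bool" where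
  "AssumptionV \<sigma> I \<phi> \<gamma> V \<longleftrightarrow> finite V \<and>
    (\<forall>x\<in>V. \<exists>v \<alpha> r. norm v = 1 \<and> \<alpha> > 0 \<and> r > 0 \<and>
       (\<forall>y\<in>closure (GG I \<phi>) \<inter> cball x r.
           inner v (y - x) \<ge> \<alpha> * norm (y - x)
         \<and> inner v (amat \<sigma> y *v v) \<ge> \<alpha>
         \<and> (\<forall>d\<in>dcone I \<phi> \<gamma> y. inner v d \<ge> 0)))"

end

theory Submission
  imports Defs
begin

text \<open>
  Near a point \<open>z\<close> of the closed domain, a decreasing cutoff of the barrier
  \<open>w \<mapsto> \<langle>n, w\<rangle> + \<kappa> |w|\<^sup>2\<close>, \<open>w = y - z\<close>, is a bump that decreases along the reflection directions.
  For \<open>z \<in> V\<close> take \<open>\<kappa> = 0\<close> and \<open>n\<close> a multiple of \<open>v_z\<close>; otherwise \<open>n\<close> is a large multiple of the normal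
  furnished by \<open>z \<in> U\<close>, and the quadratic term makes the barrier large on a small sphere about \<open>z\<close>.
  The test function \<open>f_{x,\<epsilon>}\<close> is the sum of the bumps, centred at grid-selected points, that stay away from \<open>x\<close>.

  This needs bumps of uniform size. If there were none, some sequence of points would need ever
  smaller bumps. A bounded sequence accumulates at a point, whose bump serves all nearby points. In an unbounded
  polyhedral domain one passes to a subsequence along which each slack \<open>\<langle>\<nu>_i, y\<rangle> - \<beta>_i\<close> converges or tends to
  infinity; a vanishing correction makes the convergent slacks constant, so the corrected points all have the same
  active constraints and translates of a single bump work for all of them.
\<close>

section \<open>Twice continuously differentiable functions\<close>

lemma pd_eqI:
  assumes "(f has_derivative f') (at x)"
  shows "pd i f x = f' (axis i 1)"
  using frechet_derivative_at[OF assms] by (simp add: pd_def)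

lemma inner_grad:
  assumes "(f has_derivative f') (at x)"
  shows "inner d (grad f x) = f' d"
proof -
  interpret linear f' using assms has_derivative_linear by blast
  have "f' d = f' (\<Sum>i\<in>UNIV. (d $ i) *\<^sub>R axis i 1)"
    by (metis basis_expansion scalar_mult_eq_scaleR)
  also have "\<dots> = (\<Sum>i\<in>UNIV. d $ i * f' (axis i 1))"
    by (simp add: sum scale)
  finally show ?thesis
    by (simp add: inner_vec_def grad_def pd_eqI[OF assms])
qed

lemma has_derivative_inner_grad:
  assumes "f differentiable (at x)"
  shows "(f has_derivative (\<lambda>d. inner d (grad f x))) (at x)"
  using assms inner_grad[of f _ x] unfolding differentiable_def by (metis ext)

lemma has_derivative_cong_open:
  assumes "open U" "x \<in> U" "\<And>y. y \<in> U \<Longrightarrow> f y = g y"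
  shows "(f has_derivative f') (at x) \<longleftrightarrow> (g has_derivative f') (at x)"
  using has_derivative_transform_within_open[of f f' x UNIV U g]
    has_derivative_transform_within_open[of g f' x UNIV U f] assms by auto

lemma differentiable_cong_open:
  assumes "open U" "x \<in> U" "\<And>y. y \<in> U \<Longrightarrow> f y = g y"
  shows "f differentiable (at x) \<longleftrightarrow> g differentiable (at x)"
  by (simp add: differentiable_def has_derivative_cong_open[OF assms])

lemma pd_cong_open:
  assumes "open U" "x \<in> U" "\<And>y. y \<in> U \<Longrightarrow> f y = g y"
  shows "pd i f x = pd i g x"
  by (simp add: pd_def frechet_derivative_def has_derivative_cong_open[OF assms])

lemma pd_const: "pd i (\<lambda>_. c) = (\<lambda>_. 0)"
  by (rule ext, subst pd_eqI[where f' = "\<lambda>_. 0"]) auto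

lemma pd_inner: "pd i (inner n) = (\<lambda>_. inner n (axis i 1))"
  by (rule ext, rule pd_eqI) (auto intro!: derivative_eq_intros)

lemma pd_add:
  assumes "f differentiable (at x)" "g differentiable (at x)"
  shows "pd i (\<lambda>y. f y + g y) x = pd i f x + pd i g x"
  using pd_eqI[OF has_derivative_add[OF assms[unfolded frechet_derivative_works]]]
  by (simp add: pd_def)

lemma pd_mult:
  assumes "f differentiable (at x)" "g differentiable (at x)"
  shows "pd i (\<lambda>y. f y * g y) x = pd i f x * g x + f x * pd i g x"
  using pd_eqI[OF has_derivative_mult[OF assms[unfolded frechet_derivative_works]]]
  by (simp add: pd_def)

lemma pd_sum:
  assumes "finite S" "\<And>k. k \<in> S \<Longrightarrow> h k differentiable (at x)"
  shows "pd i (\<lambda>y. \<Sum>k\<in>S. h k y) x = (\<Sum>k\<in>S. pd i (h k) x)"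
  using assms
  by (induction S rule: finite_induct) (auto simp: pd_const pd_add)

lemma has_derivative_compose_real:
  assumes "(p has_real_derivative p') (at (f x))" "f differentiable (at x)"
  shows "((\<lambda>y. p (f y)) has_derivative (\<lambda>h. p' * frechet_derivative f (at x) h)) (at x)"
  using has_derivative_compose[OF assms(2)[unfolded frechet_derivative_works]
      assms(1)[unfolded has_field_derivative_def]] .

lemma differentiable_compose_real:
  assumes "(p has_real_derivative p') (at (f x))" "f differentiable (at x)"
  shows "(\<lambda>y. p (f y)) differentiable (at x)"
  using has_derivative_compose_real[OF assms] unfolding differentiable_def by blast

lemma pd_compose_real:
  assumes "(p has_real_derivative p') (at (f x))" "f differentiable (at x)"
  shows "pd i (\<lambda>y. p (f y)) x = p' * pd i f x"
  using pd_eqI[OF has_derivative_compose_real[OF assms]] by (simp add: pd_def)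

lemma has_derivative_translate_iff:
  "((\<lambda>y. f (y - z)) has_derivative f') (at x) \<longleftrightarrow> (f has_derivative f') (at (x - z))"
  for f :: "'a::real_normed_vector \<Rightarrow> 'b::real_normed_vector"
proof
  assume "(f has_derivative f') (at (x - z))"
  then show "((\<lambda>y. f (y - z)) has_derivative f') (at x)"
    using has_derivative_compose[OF has_derivative_diff[OF has_derivative_ident has_derivative_const],
        of f f' x z] by simp
next
  assume "((\<lambda>y. f (y - z)) has_derivative f') (at x)"
  then show "(f has_derivative f') (at (x - z))"
    using has_derivative_compose[OF has_derivative_add[OF has_derivative_ident has_derivative_const],
        of "\<lambda>y. f (y - z)" f' "x - z" z] by simp
qed

lemma pd_translate: "pd i (\<lambda>y. f (y - z)) = (\<lambda>x. pd i f (x - z))"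
  by (rule ext) (simp add: pd_def frechet_derivative_def has_derivative_translate_iff)

lemma C2_onI:
  assumes U: "open U" and f: "\<And>x. x \<in> U \<Longrightarrow> f differentiable (at x)"
    and f': "\<And>j x. x \<in> U \<Longrightarrow> pd j f x = f' j x" "\<And>j x. x \<in> U \<Longrightarrow> f' j differentiable (at x)"
    and f'': "\<And>i j x. x \<in> U \<Longrightarrow> pd i (f' j) x = f'' i j x" "\<And>i j. continuous_on U (f'' i j)"
  shows "C2_on U f"
  unfolding C2_on_def
proof (intro conjI allI ballI U f)
  fix j x assume x: "x \<in> U"
  show "pd j f differentiable (at x)"
    using differentiable_cong_open[OF U x, of "pd j f" "f' j"] f'(1) f'(2)[OF x] by simp
next
  fix i j
  have "pd i (pd j f) x = f'' i j x" if x: "x \<in> U" for x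
    using pd_cong_open[OF U x, of "pd j f" "f' j" i] f'(1) f''(1)[OF x] by simp
  then show "continuous_on U (pd i (pd j f))"
    using f''(2) by (subst continuous_on_cong[OF refl]) auto
qed

lemma C2_onD:
  assumes "C2_on U f"
  shows "open U" "x \<in> U \<Longrightarrow> f differentiable (at x)" "x \<in> U \<Longrightarrow> pd j f differentiable (at x)"
    "continuous_on U (pd i (pd j f))" "continuous_on U (pd j f)" "continuous_on U f"
proof -
  show "open U" "x \<in> U \<Longrightarrow> f differentiable (at x)" "x \<in> U \<Longrightarrow> pd j f differentiable (at x)"
    "continuous_on U (pd i (pd j f))"
    using assms by (auto simp: C2_on_def)
  show "continuous_on U (pd j f)" "continuous_on U f"
    using assms by (auto simp: C2_on_def intro!: continuous_at_imp_continuous_on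
        differentiable_imp_continuous_within)
qed

lemma C2_on_cong:
  assumes g: "C2_on U g" and "\<And>y. y \<in> U \<Longrightarrow> f y = g y"
  shows "C2_on U f"
proof (rule C2_onI)
  show "open U" by (rule C2_onD[OF g])
  show "f differentiable (at x)" if "x \<in> U" for x
    using differentiable_cong_open[OF C2_onD(1)[OF g] that, of f g] assms(2) C2_onD(2)[OF g that] by blast
  show "pd j f x = pd j g x" if "x \<in> U" for j x
    by (rule pd_cong_open[OF C2_onD(1)[OF g] that assms(2)])
  show "continuous_on U (pd i (pd j g))" for i j by (rule C2_onD[OF g])
qed (use C2_onD[OF g] in auto)

lemma C2_on_subset: "C2_on U f \<Longrightarrow> open W \<Longrightarrow> W \<subseteq> U \<Longrightarrow> C2_on W f"
  unfolding C2_on_def by (blast intro: continuous_on_subset)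

lemma C2_on_Union:
  assumes "\<And>U. U \<in> \<U> \<Longrightarrow> C2_on U f"
  shows "C2_on (\<Union>\<U>) f"
  using assms unfolding C2_on_def by (auto intro!: open_Union continuous_on_open_Union)

lemma C2_on_const: "open U \<Longrightarrow> C2_on U (\<lambda>_. c)"
  by (simp add: C2_on_def pd_const)

lemma C2_on_inner: "open U \<Longrightarrow> C2_on U (inner n)"
  by (auto simp: C2_on_def pd_inner pd_const
      intro: bounded_linear_imp_differentiable bounded_linear_inner_right)

lemma C2_on_add:
  assumes f: "C2_on U f" and g: "C2_on U g"
  shows "C2_on U (\<lambda>y. f y + g y)"
proof (rule C2_onI)
  show "pd j (\<lambda>y. f y + g y) x = pd j f x + pd j g x" if "x \<in> U" for j x
    by (intro pd_add C2_onD(2)[OF f] C2_onD(2)[OF g] that)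
  show "pd i (\<lambda>y. pd j f y + pd j g y) x = pd i (pd j f) x + pd i (pd j g) x" if "x \<in> U" for i j x
    by (intro pd_add C2_onD(3)[OF f] C2_onD(3)[OF g] that)
qed (use C2_onD[OF f] C2_onD[OF g] in \<open>auto intro!: continuous_on_add differentiable_add\<close>)

lemma C2_on_mult:
  assumes f: "C2_on U f" and g: "C2_on U g"
  shows "C2_on U (\<lambda>y. f y * g y)"
proof (rule C2_onI)
  show "pd j (\<lambda>y. f y * g y) x = pd j f x * g x + f x * pd j g x" if "x \<in> U" for j x
    by (intro pd_mult C2_onD(2)[OF f] C2_onD(2)[OF g] that)
  show "pd i (\<lambda>y. pd j f y * g y + f y * pd j g y) x = (pd i (pd j f) x * g x + pd j f x * pd i g x)
      + (pd i f x * pd j g x + f x * pd i (pd j g) x)" if "x \<in> U" for i j x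
    using C2_onD(2,3)[OF f that] C2_onD(2,3)[OF g that] by (simp add: pd_add pd_mult)
qed (use C2_onD[OF f] C2_onD[OF g] in \<open>auto intro!: continuous_on_add continuous_on_mult
    differentiable_add differentiable_mult\<close>)

lemma C2_on_sum:
  assumes "open U" "finite S" "\<And>k. k \<in> S \<Longrightarrow> C2_on U (h k)"
  shows "C2_on U (\<lambda>y. \<Sum>k\<in>S. h k y)"
  using assms(2,3,1) by (induction S rule: finite_induct) (auto intro: C2_on_const C2_on_add)

lemma C2_on_norm_square:
  assumes "open U"
  shows "C2_on U (\<lambda>y::real^'J::finite. (norm y)\<^sup>2)"
proof -
  have "(norm y)\<^sup>2 = (\<Sum>i\<in>UNIV. inner (axis i 1) y * inner (axis i 1) y)" for y :: "real^'J"
    unfolding power2_norm_eq_inner inner_axis' by (simp add: inner_vec_def)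
  then show ?thesis
    by (simp only:) (intro C2_on_sum C2_on_mult C2_on_inner assms finite)
qed

lemma C2_on_compose_real:
  fixes p p' p'' :: "real \<Rightarrow> real"
  assumes p: "\<And>s. s \<in> W \<Longrightarrow> (p has_real_derivative p' s) (at s)"
    and p': "\<And>s. s \<in> W \<Longrightarrow> (p' has_real_derivative p'' s) (at s)" and p'': "continuous_on W p''"
    and f: "C2_on U f" and fW: "f ` U \<subseteq> W"
  shows "C2_on U (\<lambda>y. p (f y))"
proof (rule C2_onI)
  note D = C2_onD[OF f]
  have W: "f x \<in> W" if "x \<in> U" for x using that fW by blast
  show "open U" by (rule D)
  show "(\<lambda>y. p (f y)) differentiable (at x)" if "x \<in> U" for x
    by (rule differentiable_compose_real[OF p[OF W[OF that]] D(2)[OF that]])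
  have dp': "(\<lambda>y. p' (f y)) differentiable (at x)" if "x \<in> U" for x
    by (rule differentiable_compose_real[OF p'[OF W[OF that]] D(2)[OF that]])
  show "pd j (\<lambda>y. p (f y)) x = p' (f x) * pd j f x" if "x \<in> U" for j x
    by (rule pd_compose_real[OF p[OF W[OF that]] D(2)[OF that]])
  show "(\<lambda>y. p' (f y) * pd j f y) differentiable (at x)" if "x \<in> U" for j x
    by (intro differentiable_mult dp' D(3) that)
  show "pd i (\<lambda>y. p' (f y) * pd j f y) x =
      (p'' (f x) * pd i f x) * pd j f x + p' (f x) * pd i (pd j f) x" if "x \<in> U" for i j x
    using pd_compose_real[OF p'[OF W[OF that]] D(2)[OF that]]
    by (simp add: pd_mult dp' D(3) that)
  have "continuous_on U (\<lambda>y. p'' (f y))"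
    by (rule continuous_on_compose2[OF p'' D(6) fW])
  moreover have "continuous_on U (\<lambda>y. p' (f y))"
    using dp' by (intro continuous_at_imp_continuous_on ballI differentiable_imp_continuous_within)
  ultimately show "continuous_on U (\<lambda>y. (p'' (f y) * pd i f y) * pd j f y + p' (f y) * pd i (pd j f) y)"
    for i j by (intro continuous_on_add continuous_on_mult D(4,5))
qed

lemma C2_on_translate:
  assumes f: "C2_on U f"
  shows "C2_on ((\<lambda>y. y - z) -` U) (\<lambda>y. f (y - z))"
proof -
  have "continuous_on ((\<lambda>y. y - z) -` U) (\<lambda>y. pd i (pd j f) (y - z))" for i j
    by (rule continuous_on_compose2[OF C2_onD(4)[OF f]]) (auto intro: continuous_intros)
  moreover have "open ((\<lambda>y. y - z) -` U)"
    by (intro open_vimage C2_onD(1)[OF f] continuous_intros)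
  ultimately show ?thesis
    using C2_onD(2,3)[OF f]
    by (auto simp: C2_on_def pd_translate differentiable_def has_derivative_translate_iff)
qed

definition jet_le :: "real \<Rightarrow> (real^'J::finite \<Rightarrow> real) \<Rightarrow> real^'J \<Rightarrow> bool" where
  "jet_le D f x \<longleftrightarrow> \<bar>f x\<bar> \<le> D \<and> (\<forall>i. \<bar>pd i f x\<bar> \<le> D) \<and> (\<forall>i j. \<bar>pd i (pd j f) x\<bar> \<le> D)"

lemma jet_le_mono: "jet_le D f x \<Longrightarrow> D \<le> E \<Longrightarrow> jet_le E f x"
  unfolding jet_le_def by (meson order_trans)

lemma jet_le_translate: "jet_le D (\<lambda>y. f (y - z)) x \<longleftrightarrow> jet_le D f (x - z)"
  by (simp add: jet_le_def pd_translate)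

lemma jet_le_cong_open:
  assumes "open U" "x \<in> U" "\<And>y. y \<in> U \<Longrightarrow> f y = g y"
  shows "jet_le D f x \<longleftrightarrow> jet_le D g x"
proof -
  have pd: "pd i f y = pd i g y" if "y \<in> U" for i y
    by (rule pd_cong_open[OF assms(1) that assms(3)])
  have "pd i (pd j f) x = pd i (pd j g) x" for i j
    by (rule pd_cong_open[OF assms(1,2) pd])
  then show ?thesis
    by (simp add: jet_le_def pd assms(2,3))
qed

lemma jet_le_sum:
  fixes D :: real
  assumes "finite S" and C2: "\<And>k. k \<in> S \<Longrightarrow> C2_on UNIV (h k)"
    and D: "\<And>k. k \<in> S \<Longrightarrow> jet_le D (h k) x"
  shows "jet_le (card S * D) (\<lambda>y. \<Sum>k\<in>S. h k y) x"
proof -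
  have pd: "pd j (\<lambda>y. \<Sum>k\<in>S. h k y) = (\<lambda>y. \<Sum>k\<in>S. pd j (h k) y)" for j
    using assms(1) C2_onD(2)[OF C2] by (intro ext pd_sum) auto
  have pd_pd: "pd i (\<lambda>y. \<Sum>k\<in>S. pd j (h k) y) x = (\<Sum>k\<in>S. pd i (pd j (h k)) x)" for i j
    using assms(1) C2_onD(3)[OF C2] by (intro pd_sum) auto
  have "\<bar>\<Sum>k\<in>S. a k\<bar> \<le> card S * D" if "\<And>k. k \<in> S \<Longrightarrow> \<bar>a k\<bar> \<le> D" for a :: "_ \<Rightarrow> real"
    using order_trans[OF sum_abs sum_bounded_above[of S "\<lambda>k. \<bar>a k\<bar>" D]] that by simp
  then show ?thesis
    using D by (simp add: jet_le_def pd pd_pd)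
qed

lemma continuous_compact_support_bounded:
  fixes g :: "'a::euclidean_space \<Rightarrow> real"
  assumes "continuous_on UNIV g" "\<And>w. \<rho> < norm w \<Longrightarrow> g w = 0"
  shows "\<exists>B>0. \<forall>w. \<bar>g w\<bar> \<le> B"
proof -
  have "compact (g ` cball 0 \<rho>)"
    using assms(1) by (intro compact_continuous_image) (auto intro: continuous_on_subset)
  then obtain B where B: "B > 0" "\<forall>x\<in>g ` cball 0 \<rho>. norm x \<le> B"
    using compact_imp_bounded bounded_pos by blast
  have "\<bar>g w\<bar> \<le> B" for w
    using B assms(2)[of w] by (cases "norm w \<le> \<rho>") auto
  with B(1) show ?thesis by blast
qed

lemma jet_le_if_compact_support:
  fixes f :: "real^'J::finite \<Rightarrow> real"
  assumes C2: "C2_on UNIV f" and supp: "\<And>w. \<rho> < norm w \<Longrightarrow> f w = 0"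
  obtains D where "D > 0" "\<And>w. jet_le D f w"
proof -
  have out: "open {w::real^'J. \<rho> < norm w}"
    by (intro open_Collect_less continuous_intros)
  have pd: "pd j f w = 0" if "\<rho> < norm w" for w j
    using pd_cong_open[OF out, of w f "\<lambda>_. 0" j] that supp by (simp add: pd_const)
  have pd_pd: "pd i (pd j f) w = 0" if "\<rho> < norm w" for w i j
    using pd_cong_open[OF out, of w "pd j f" "\<lambda>_. 0" i] that pd by (simp add: pd_const)
  obtain B0 where B0: "B0 > 0" "\<And>w. \<bar>f w\<bar> \<le> B0"
    using continuous_compact_support_bounded[OF C2_onD(6)[OF C2] supp] by blast
  obtain B1 where B1: "\<And>j. B1 j > 0" "\<And>j w. \<bar>pd j f w\<bar> \<le> B1 j"
    using continuous_compact_support_bounded[OF C2_onD(5)[OF C2] pd] by metis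
  obtain B2 where B2: "\<And>i j. B2 i j > 0" "\<And>i j w. \<bar>pd i (pd j f) w\<bar> \<le> B2 i j"
    using continuous_compact_support_bounded[OF C2_onD(4)[OF C2] pd_pd] by metis
  define D where "D = Max (insert B0 (range B1 \<union> range (case_prod B2)))"
  have D: "B0 \<le> D" "B1 j \<le> D" "B2 i j \<le> D" for i j
    unfolding D_def by (rule Max_ge; force)+
  show ?thesis
  proof
    show "D > 0" using B0(1) D(1) by linarith
    show "jet_le D f w" for w
      unfolding jet_le_def using B0(2) B1(2) B2(2) D order_trans by blast
  qed
qed

section \<open>Bumps\<close>

lemma has_real_derivative_max_0_power:
  assumes "2 \<le> n"
  shows "((\<lambda>s::real. max 0 s ^ n) has_real_derivative real n * max 0 s ^ (n - 1)) (at s)"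
proof -
  consider "s > 0" | "s < 0" | "s = 0" by linarith
  then show ?thesis
  proof cases
    assume s: "s > 0"
    then have "((\<lambda>s. s ^ n) has_real_derivative real n * max 0 s ^ (n - 1)) (at s)"
      using DERIV_pow[of n s] by (simp add: max_def)
    then show ?thesis
      by (rule has_field_derivative_transform_within_open[where S = "{0<..}"]) (use s in auto)
  next
    assume s: "s < 0"
    have "((\<lambda>s. 0) has_real_derivative real n * max 0 s ^ (n - 1)) (at s)"
      using s assms by (auto intro!: derivative_eq_intros simp: max_def)
    then show ?thesis
      by (rule has_field_derivative_transform_within_open[where S = "{..<0}"]) (use s assms in auto)
  next
    assume s: "s = 0"
    obtain m where n: "n = Suc (Suc m)"
      using assms by (metis add_2_eq_Suc le_Suc_ex)
    have "((\<lambda>h::real. \<bar>h\<bar> ^ Suc m) \<longlongrightarrow> 0) (at 0)"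
      by (auto intro!: tendsto_eq_intros)
    from tendsto_sandwich[OF _ _ tendsto_const this]
    have "((\<lambda>h::real. max 0 h ^ n / h) \<longlongrightarrow> 0) (at 0)"
      by (rule tendsto_rabs_zero_cancel)
         (auto intro!: always_eventually simp: n max_def abs_mult power_abs mult_nonpos_nonneg)
    then show ?thesis
      using s n by (simp add: DERIV_def)
  qed
qed

definition cutoff :: "real \<Rightarrow> real" where
  "cutoff s = max 0 (1 - max 0 (s - 1) ^ 3) ^ 3"

definition cutoff_deriv :: "real \<Rightarrow> real" where
  "cutoff_deriv s = - 9 * max 0 (s - 1) ^ 2 * max 0 (1 - max 0 (s - 1) ^ 3) ^ 2"

definition cutoff_deriv2 :: "real \<Rightarrow> real" where
  "cutoff_deriv2 s = 54 * max 0 (s - 1) ^ 4 * max 0 (1 - max 0 (s - 1) ^ 3)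
     - 18 * max 0 (s - 1) * max 0 (1 - max 0 (s - 1) ^ 3) ^ 2"

lemma cutoff_has_derivatives:
  "(cutoff has_real_derivative cutoff_deriv s) (at s)"
  "(cutoff_deriv has_real_derivative cutoff_deriv2 s) (at s)"
proof -
  have shift: "((\<lambda>s. s - 1) has_real_derivative 1) (at s)"
    by (auto intro!: derivative_eq_intros)
  have outer: "((\<lambda>s. max 0 (s - 1) ^ k) has_real_derivative k * max 0 (s - 1) ^ (k - 1)) (at s)"
    if "2 \<le> k" for k :: nat
    using DERIV_chain2[OF has_real_derivative_max_0_power[OF that] shift] by simp
  have "((\<lambda>s. 1 - max 0 (s - 1) ^ 3) has_real_derivative - 3 * max 0 (s - 1) ^ 2) (at s)"
    using DERIV_diff[OF DERIV_const outer[of 3], of 1] by simp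
  note inner = DERIV_chain2[OF has_real_derivative_max_0_power this]
  show "(cutoff has_real_derivative cutoff_deriv s) (at s)"
    using inner[of 3] by (simp add: cutoff_def[abs_def] cutoff_deriv_def mult_ac)
  have "((\<lambda>s. - 9 * (max 0 (s - 1) ^ 2 * max 0 (1 - max 0 (s - 1) ^ 3) ^ 2)) has_real_derivative
      cutoff_deriv2 s) (at s)"
    by (rule DERIV_cong[OF DERIV_cmult[OF DERIV_mult[OF outer[of 2] inner[of 2]]]])
      (simp_all add: cutoff_deriv2_def algebra_simps power2_eq_square power4_eq_xxxx)
  then show "(cutoff_deriv has_real_derivative cutoff_deriv2 s) (at s)"
    by (simp add: cutoff_deriv_def[abs_def] mult.assoc)
qed

lemma continuous_on_cutoff_deriv2: "continuous_on S cutoff_deriv2"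
  unfolding cutoff_deriv2_def[abs_def] by (intro continuous_intros)

lemma cutoff_nonneg: "0 \<le> cutoff s"
  by (simp add: cutoff_def)

lemma cutoff_eq_1: "s \<le> 1 \<Longrightarrow> cutoff s = 1"
  by (simp add: cutoff_def)

lemma cutoff_deriv_nonpos: "cutoff_deriv s \<le> 0"
  by (simp add: cutoff_deriv_def mult_nonpos_nonneg)

lemma cutoff_eq_0:
  assumes "2 \<le> s"
  shows "cutoff s = 0" "cutoff_deriv s = 0"
  using assms one_le_power[of "s - 1" 3] by (simp_all add: cutoff_def cutoff_deriv_def max_def del: one_le_power)

lemma cutoff_deriv_eq_0: "s \<le> 1 \<Longrightarrow> cutoff_deriv s = 0"
  by (simp add: cutoff_deriv_def)

lemma C2_on_cutoff: "C2_on U f \<Longrightarrow> C2_on U (\<lambda>y. cutoff (f y))"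
  by (rule C2_on_compose_real[where W = UNIV, OF cutoff_has_derivatives continuous_on_cutoff_deriv2])
    auto

definition barrier :: "real^'J::finite \<Rightarrow> real \<Rightarrow> real^'J \<Rightarrow> real" where
  "barrier n \<kappa> w = inner n w + \<kappa> * (norm w)\<^sup>2"

definition bump :: "real^'J::finite \<Rightarrow> real \<Rightarrow> real \<Rightarrow> real^'J \<Rightarrow> real" where
  "bump n \<kappa> \<rho> w = cutoff (barrier n \<kappa> w) * cutoff ((2 / \<rho>)\<^sup>2 * (norm w)\<^sup>2)"

lemma barrier_scale: "barrier (A *\<^sub>R n) (A * \<kappa>) w = A * barrier n \<kappa> w"
  by (simp add: barrier_def algebra_simps)

lemma barrier_ge_off_center:
  assumes "0 < \<rho>" "0 \<le> \<kappa>" "0 < m + \<kappa> * \<rho>"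
    and w: "\<rho> \<le> norm w" and n: "m * norm w \<le> inner n w"
  shows "(m + \<kappa> * \<rho>) * \<rho> \<le> barrier n \<kappa> w"
proof -
  have "\<kappa> * \<rho> \<le> \<kappa> * norm w" using w assms(2) by (rule mult_left_mono)
  then have "(m + \<kappa> * \<rho>) * \<rho> \<le> (m + \<kappa> * norm w) * norm w"
    using w assms(1,3) by (intro mult_mono) auto
  also have "\<dots> \<le> barrier n \<kappa> w"
    using n by (simp add: barrier_def algebra_simps power2_eq_square)
  finally show ?thesis .
qed

lemma C2_on_barrier: "open U \<Longrightarrow> C2_on U (barrier n \<kappa>)"
  unfolding barrier_def[abs_def]
  by (intro C2_on_add C2_on_mult C2_on_inner C2_on_norm_square C2_on_const)

lemma C2_on_bump: "open U \<Longrightarrow> C2_on U (bump n \<kappa> \<rho>)"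
  unfolding bump_def[abs_def]
  by (intro C2_on_mult C2_on_cutoff C2_on_barrier C2_on_norm_square C2_on_const)

lemma bump_nonneg: "0 \<le> bump n \<kappa> \<rho> w"
  by (simp add: bump_def cutoff_nonneg)

lemma radial_cutoff_argument:
  fixes w :: "'a::real_normed_vector"
  assumes "0 < \<rho>"
  shows "norm w \<le> \<rho> / 2 \<Longrightarrow> (2 / \<rho>)\<^sup>2 * (norm w)\<^sup>2 \<le> 1" "\<rho> \<le> norm w \<Longrightarrow> 2 \<le> (2 / \<rho>)\<^sup>2 * (norm w)\<^sup>2"
proof -
  show "(2 / \<rho>)\<^sup>2 * (norm w)\<^sup>2 \<le> 1" if "norm w \<le> \<rho> / 2"
    using power_mono[OF that, of 2] assms by (simp add: field_simps)
  show "2 \<le> (2 / \<rho>)\<^sup>2 * (norm w)\<^sup>2" if "\<rho> \<le> norm w"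
  proof -
    have "2 ^ 2 \<le> (2 / \<rho> * norm w)\<^sup>2"
      using that assms by (intro power_mono) (auto simp: field_simps)
    then show ?thesis unfolding power_mult_distrib by simp
  qed
qed

lemma bump_eq_0: "0 < \<rho> \<Longrightarrow> \<rho> \<le> norm w \<Longrightarrow> bump n \<kappa> \<rho> w = 0"
  by (simp add: bump_def cutoff_eq_0 radial_cutoff_argument)

lemma eventually_bump_eq_1: "\<forall>\<^sub>F w in nhds 0. bump n \<kappa> \<rho> w = 1"
proof -
  let ?U = "{w. barrier n \<kappa> w < 1 \<and> (2 / \<rho>)\<^sup>2 * (norm w)\<^sup>2 < 1}"
  have "open ?U"
    using C2_onD(6)[OF C2_on_barrier[OF open_UNIV]]
    by (intro open_Collect_conj open_Collect_less continuous_intros)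
  then have "\<forall>\<^sub>F w in nhds 0. w \<in> ?U"
    by (rule eventually_nhds_in_open) (simp add: barrier_def)
  then show ?thesis
    by eventually_elim (simp add: bump_def cutoff_eq_1)
qed

lemma bump_scale:
  assumes "0 < \<rho>"
  obtains r where "0 < r" "\<And>w. norm w < r \<Longrightarrow> bump n \<kappa> \<rho> w = 1" "\<And>w. jet_le (1 / r) (bump n \<kappa> \<rho>) w"
proof -
  obtain r where r: "0 < r" "\<And>w. norm w < r \<Longrightarrow> bump n \<kappa> \<rho> w = 1"
    using eventually_bump_eq_1[of n \<kappa> \<rho>] unfolding eventually_nhds_metric by auto
  obtain D where D: "0 < D" "\<And>w. jet_le D (bump n \<kappa> \<rho>) w"
    using jet_le_if_compact_support[OF C2_on_bump[OF open_UNIV], of \<rho>] bump_eq_0[OF assms]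
    by (metis less_imp_le)
  have "D \<le> 1 / min r (1 / D)"
    using D(1) r(1) by (simp add: min_def field_simps)
  with r D show ?thesis
    by (intro that[of "min r (1 / D)"]) (auto intro: jet_le_mono)
qed

lemma has_derivative_norm_square:
  "((\<lambda>w. (norm w)\<^sup>2) has_derivative (\<lambda>h. 2 * inner w h)) (at w)"
  for w :: "'a::real_inner"
  unfolding power2_norm_eq_inner by (auto intro!: derivative_eq_intros simp: inner_commute)

lemma has_derivative_barrier:
  "(barrier n \<kappa> has_derivative (\<lambda>h. inner h (n + (2 * \<kappa>) *\<^sub>R w))) (at w)"
  unfolding barrier_def[abs_def]
  by (rule has_derivative_eq_rhs[OF has_derivative_add[OF
        has_derivative_inner_right[OF has_derivative_ident]
        has_derivative_mult_right[OF has_derivative_norm_square]]])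
    (simp add: fun_eq_iff inner_add_right inner_commute)

text \<open>Where the radial cutoff is not locally constant, the barrier is so large that its cutoff vanishes.\<close>

lemma inner_grad_bump_nonpos:
  assumes \<rho>: "0 < \<rho>"
    and direction: "norm w \<le> \<rho> \<Longrightarrow> 0 \<le> inner d (n + (2 * \<kappa>) *\<^sub>R w)"
    and shell: "\<rho> / 2 \<le> norm w \<Longrightarrow> norm w \<le> \<rho> \<Longrightarrow> 2 \<le> barrier n \<kappa> w"
  shows "inner d (grad (bump n \<kappa> \<rho>) w) \<le> 0"
proof -
  let ?q = "(2 / \<rho>)\<^sup>2 * (norm w)\<^sup>2"
  note chain = has_derivative_compose[OF _ cutoff_has_derivatives(1)[unfolded has_field_derivative_def]]
  have "inner d (grad (bump n \<kappa> \<rho>) w) =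
      cutoff (barrier n \<kappa> w) * (cutoff_deriv ?q * ((2 / \<rho>)\<^sup>2 * (2 * inner w d)))
    + cutoff_deriv (barrier n \<kappa> w) * inner d (n + (2 * \<kappa>) *\<^sub>R w) * cutoff ?q"
    unfolding bump_def[abs_def]
    by (rule inner_grad[OF has_derivative_mult[OF chain[OF has_derivative_barrier]
          chain[OF has_derivative_mult_right[OF has_derivative_norm_square]]]])
  also have "\<dots> \<le> 0"
  proof (cases "norm w \<le> \<rho>")
    case True
    have "cutoff (barrier n \<kappa> w) = 0 \<or> cutoff_deriv ?q = 0"
      using radial_cutoff_argument(1)[OF \<rho>, of w] cutoff_deriv_eq_0[of ?q] cutoff_eq_0(1) shell True
      by (meson nle_le)
    moreover have "cutoff_deriv (barrier n \<kappa> w) * inner d (n + (2 * \<kappa>) *\<^sub>R w) * cutoff ?q \<le> 0"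
      by (intro mult_nonpos_nonneg direction True cutoff_deriv_nonpos cutoff_nonneg)
    ultimately show ?thesis by auto
  next
    case False
    then have "2 \<le> ?q" using radial_cutoff_argument(2)[OF \<rho>, of w] by simp
    then show ?thesis by (simp add: cutoff_eq_0)
  qed
  finally show ?thesis .
qed

section \<open>Locally finite sums of bumps\<close>

definition grid_cell :: "real \<Rightarrow> real^'J::finite \<Rightarrow> int^'J" where
  "grid_cell s y = (\<chi> i. \<lfloor>y $ i / s\<rfloor>)"

lemma dist_le_if_grid_cell_eq:
  fixes x y :: "real^'J::finite"
  assumes "s > 0" "grid_cell s x = grid_cell s y"
  shows "dist x y \<le> real CARD('J) * s"
proof -
  have "\<bar>(x - y) $ i\<bar> \<le> s" for i
  proof -
    have "\<lfloor>x $ i / s\<rfloor> = \<lfloor>y $ i / s\<rfloor>"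
      using assms(2) by (simp add: grid_cell_def vec_eq_iff)
    then have "\<bar>x $ i / s - y $ i / s\<bar> \<le> 1" by linarith
    then show ?thesis
      using assms(1) by (simp add: diff_divide_distrib[symmetric] abs_divide)
  qed
  then have "norm (x - y) \<le> (\<Sum>i\<in>(UNIV::'J set). s)"
    by (intro order_trans[OF norm_le_l1_cart] sum_mono)
  then show ?thesis by (simp add: dist_norm)
qed

lemma finite_grid_cell_differences:
  assumes "s > 0"
  shows "finite {grid_cell s x - grid_cell s y | x y :: real^'J::finite. dist x y \<le> R}"
proof (rule finite_subset)
  define K where "K = \<lceil>R / s\<rceil> + 1"
  show "finite (vec_lambda ` (UNIV \<rightarrow>\<^sub>E {-K..K}) :: (int^'J) set)"
    by (intro finite_imageI finite_PiE) auto
  show "{grid_cell s x - grid_cell s y | x y :: real^'J. dist x y \<le> R} \<subseteq> vec_lambda ` (UNIV \<rightarrow>\<^sub>E {-K..K})"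
  proof clarify
    fix x y :: "real^'J"
    assume R: "dist x y \<le> R"
    have "(grid_cell s x - grid_cell s y) $ i \<in> {-K..K}" for i
    proof -
      have "\<bar>x $ i - y $ i\<bar> \<le> R"
        using component_le_norm_cart[of "x - y" i] R by (simp add: dist_norm)
      then have "\<bar>x $ i / s - y $ i / s\<bar> \<le> R / s"
        using assms by (simp add: diff_divide_distrib[symmetric] divide_right_mono abs_divide)
      then show ?thesis unfolding grid_cell_def K_def by simp linarith
    qed
    then have "($) (grid_cell s x - grid_cell s y) \<in> UNIV \<rightarrow>\<^sub>E {-K..K}" by auto
    then show "grid_cell s x - grid_cell s y \<in> vec_lambda ` (UNIV \<rightarrow>\<^sub>E {-K..K})"
      by (metis image_eqI vec_nth_inverse)
  qed
qed

lemma locally_finite_net_exists: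
  fixes S :: "(real^'J::finite) set"
  assumes r: "r > 0"
  obtains A :: "nat set" and z :: "nat \<Rightarrow> real^'J" and M :: nat
  where "\<And>k. k \<in> A \<Longrightarrow> z k \<in> S" "\<And>y. y \<in> S \<Longrightarrow> \<exists>k\<in>A. dist (z k) y < r"
    "\<And>y. finite {k\<in>A. dist (z k) y \<le> R}" "\<And>y. card {k\<in>A. dist (z k) y \<le> R} \<le> M"
proof -
  define s where "s = r / (real CARD('J) + 1)"
  have s: "s > 0" using r by (auto simp: s_def intro!: divide_pos_pos)
  define A where "A = to_nat ` grid_cell s ` S"
  define z where "z k = (SOME y. y \<in> S \<and> to_nat (grid_cell s y) = k)" for k
  have z: "z k \<in> S \<and> to_nat (grid_cell s (z k)) = k" if "k \<in> A" for k
    unfolding z_def by (rule someI_ex) (use that in \<open>auto simp: A_def\<close>)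
  let ?box = "{grid_cell s x - grid_cell s y | x y :: real^'J. dist x y \<le> R}"
  have box: "finite ?box" by (rule finite_grid_cell_differences[OF s])
  have inj: "inj_on (\<lambda>k. grid_cell s (z k) - grid_cell s y) {k\<in>A. dist (z k) y \<le> R}" for y
    by (rule inj_onI) (metis (no_types, lifting) diff_add_cancel mem_Collect_eq z)
  have sub: "(\<lambda>k. grid_cell s (z k) - grid_cell s y) ` {k\<in>A. dist (z k) y \<le> R} \<subseteq> ?box" for y
    by blast
  show ?thesis
  proof (rule that)
    show "z k \<in> S" if "k \<in> A" for k using z that by blast
    show "\<exists>k\<in>A. dist (z k) y < r" if "y \<in> S" for y
    proof
      show k: "to_nat (grid_cell s y) \<in> A" using that by (simp add: A_def)
      then have "dist (z (to_nat (grid_cell s y))) y \<le> real CARD('J) * s"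
        using z[OF k] by (intro dist_le_if_grid_cell_eq s) simp
      also have "\<dots> < r" using r by (simp add: s_def field_simps)
      finally show "dist (z (to_nat (grid_cell s y))) y < r" .
    qed
    show "finite {k\<in>A. dist (z k) y \<le> R}" for y
      using inj_on_finite[OF inj sub box] .
    show "card {k\<in>A. dist (z k) y \<le> R} \<le> card ?box" for y
      using card_inj_on_le[OF inj sub box] .
  qed
qed

locale locally_finite_bumps =
  fixes A :: "nat set" and z :: "nat \<Rightarrow> real^'J::finite" and h :: "nat \<Rightarrow> real^'J \<Rightarrow> real"
    and \<epsilon> D :: real and M :: nat
  assumes C2_on_bumps: "\<And>k. k \<in> A \<Longrightarrow> C2_on UNIV (h k)"
    and bumps_nonneg: "\<And>k y. k \<in> A \<Longrightarrow> 0 \<le> h k y"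
    and jet_le_bumps: "\<And>k y. k \<in> A \<Longrightarrow> jet_le D (h k) y"
    and D_nonneg: "0 \<le> D"
    and bumps_support: "\<And>k y. k \<in> A \<Longrightarrow> h k y \<noteq> 0 \<Longrightarrow> dist (z k) y \<le> \<epsilon>"
    and finite_near: "\<And>y. finite {k\<in>A. dist (z k) y \<le> \<epsilon> + 1}"
    and card_near: "\<And>y. card {k\<in>A. dist (z k) y \<le> \<epsilon> + 1} \<le> M"
begin

definition far :: "real^'J \<Rightarrow> nat set" where
  "far x = {k\<in>A. 3 * \<epsilon> / 2 < dist (z k) x}"

definition far_sum :: "real^'J \<Rightarrow> real^'J \<Rightarrow> real" where
  "far_sum x y = (\<Sum>k | k \<in> far x \<and> dist (z k) y \<le> \<epsilon> + 1. h k y)"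

lemma far_subset: "far x \<subseteq> A"
  by (auto simp: far_def)

lemma finite_near_far: "finite {k. k \<in> far x \<and> dist (z k) y \<le> \<epsilon> + 1}"
  by (rule finite_subset[OF _ finite_near[of y]]) (auto simp: far_def)

lemma card_near_far: "card {k. k \<in> far x \<and> dist (z k) y \<le> \<epsilon> + 1} \<le> M"
  by (rule order_trans[OF card_mono[OF finite_near] card_near]) (auto simp: far_def)

lemma far_sum_eq_sum:
  assumes "finite S" "S \<subseteq> far x" "\<And>k. k \<in> far x \<Longrightarrow> h k y \<noteq> 0 \<Longrightarrow> k \<in> S"
  shows "far_sum x y = (\<Sum>k\<in>S. h k y)"
  unfolding far_sum_def
proof (rule sum.mono_neutral_cong[OF assms(1) finite_near_far])
  show "h k y = 0" if "k \<in> S - {k. k \<in> far x \<and> dist (z k) y \<le> \<epsilon> + 1}" for k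
    using bumps_support[of k y] that assms(2) far_subset by fastforce
  show "h k y = 0" if "k \<in> {k. k \<in> far x \<and> dist (z k) y \<le> \<epsilon> + 1} - S" for k
    using assms(3)[of k] that by blast
qed auto

lemma far_sum_eq_sum_near:
  assumes "y \<in> ball x0 1"
  shows "far_sum x y = (\<Sum>k | k \<in> far x \<and> dist (z k) x0 \<le> \<epsilon> + 1. h k y)"
proof (rule far_sum_eq_sum[OF finite_near_far])
  fix k assume k: "k \<in> far x" "h k y \<noteq> 0"
  then have "dist (z k) y \<le> \<epsilon>" using bumps_support far_subset by blast
  then show "k \<in> {k. k \<in> far x \<and> dist (z k) x0 \<le> \<epsilon> + 1}"
    using k(1) assms dist_triangle[of "z k" x0 y] by (simp add: dist_commute)
qed auto

lemma C2_on_far_sum: "C2_on UNIV (far_sum x)"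
proof -
  have "C2_on (ball x0 1) (far_sum x)" for x0
  proof (rule C2_on_cong[OF _ far_sum_eq_sum_near])
    show "C2_on (ball x0 1) (\<lambda>y. \<Sum>k | k \<in> far x \<and> dist (z k) x0 \<le> \<epsilon> + 1. h k y)"
      using far_subset finite_near_far by (intro C2_on_sum C2_on_subset[OF C2_on_bumps]) auto
  qed
  then have "C2_on (\<Union>(range (\<lambda>x0. ball x0 1))) (far_sum x)"
    by (intro C2_on_Union) auto
  moreover have "\<Union>(range (\<lambda>x0. ball x0 1)) = (UNIV :: (real^'J) set)"
    by force
  ultimately show ?thesis by simp
qed

lemma jet_le_far_sum: "jet_le (real M * D) (far_sum x) y"
proof -
  let ?S = "{k. k \<in> far x \<and> dist (z k) y \<le> \<epsilon> + 1}"
  have "jet_le (real (card ?S) * D) (\<lambda>y. \<Sum>k\<in>?S. h k y) y"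
    using far_subset by (intro jet_le_sum finite_near_far C2_on_bumps jet_le_bumps) auto
  moreover have "jet_le (real (card ?S) * D) (far_sum x) y \<longleftrightarrow>
      jet_le (real (card ?S) * D) (\<lambda>y. \<Sum>k\<in>?S. h k y) y"
    by (rule jet_le_cong_open[OF open_ball _ far_sum_eq_sum_near]) simp_all
  ultimately have "jet_le (real (card ?S) * D) (far_sum x) y" by simp
  then show ?thesis
    by (rule jet_le_mono) (intro mult_right_mono of_nat_mono card_near_far D_nonneg)
qed

lemma sums_far_sum: "(\<lambda>k. if k \<in> far x then h k y else 0) sums far_sum x y"
proof -
  let ?S = "{k. k \<in> far x \<and> dist (z k) y \<le> \<epsilon> + 1}"
  have "(if k \<in> far x then h k y else 0) = 0" if "k \<notin> ?S" for k
  proof -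
    have "h k y \<noteq> 0 \<Longrightarrow> dist (z k) y \<le> \<epsilon> + 1" if "k \<in> far x"
      using bumps_support[of k y] that by (simp add: far_def)
    then show ?thesis using that by auto
  qed
  then have "(\<lambda>k. if k \<in> far x then h k y else 0) sums (\<Sum>k\<in>?S. if k \<in> far x then h k y else 0)"
    by (intro sums_finite finite_near_far)
  then show ?thesis by (simp add: far_sum_def)
qed

lemma far_sum_nonneg: "0 \<le> far_sum x y"
  unfolding far_sum_def using far_subset by (intro sum_nonneg bumps_nonneg) auto

lemma far_sum_eq_0:
  assumes "dist x y \<le> \<epsilon> / 2"
  shows "far_sum x y = 0"
proof (subst far_sum_eq_sum[of "{}"])
  fix k assume k: "k \<in> far x" "h k y \<noteq> 0"
  then have "dist (z k) y \<le> \<epsilon>" using bumps_support far_subset by blast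
  then have "dist (z k) x \<le> 3 * \<epsilon> / 2"
    using assms dist_triangle2[of "z k" x y] by simp
  with k(1) show "k \<in> {}" by (simp add: far_def)
qed auto

lemma bump_le_far_sum:
  assumes k: "k \<in> A" and far: "3 * \<epsilon> < dist x y" and "0 < \<epsilon>"
  shows "h k y \<le> far_sum x y"
proof (cases "h k y = 0")
  case True
  then show ?thesis by (simp add: far_sum_nonneg)
next
  case False
  then have near: "dist (z k) y \<le> \<epsilon>" by (rule bumps_support[OF k])
  then have "3 * \<epsilon> / 2 < dist (z k) x"
    using far \<open>0 < \<epsilon>\<close> dist_triangle3[of x y "z k"] by simp
  with k near have "k \<in> {k. k \<in> far x \<and> dist (z k) y \<le> \<epsilon> + 1}" by (simp add: far_def)
  then show ?thesis
    unfolding far_sum_def using far_subset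
    by (intro member_le_sum finite_near_far bumps_nonneg) auto
qed

end

lemma abs_Lgen_le:
  fixes b :: "real^'J::finite \<Rightarrow> real^'J" and \<sigma> :: "real^'J \<Rightarrow> real^'N::finite^'J"
  assumes b: "norm (b y) \<le> B" and \<sigma>: "norm (\<sigma> y) \<le> S" and f: "jet_le D f y"
  shows "\<bar>Lgen b \<sigma> f y\<bar> \<le> (real CARD('J) * B + 1/2 * (real CARD('J))\<^sup>2 * S\<^sup>2) * D"
proof -
  have a: "\<bar>amat \<sigma> y $ i $ j\<bar> \<le> S\<^sup>2" for i j
  proof -
    have row: "norm (\<sigma> y $ i) \<le> S" for i
      using Finite_Cartesian_Product.norm_nth_le[of "\<sigma> y" i] \<sigma> by linarith
    have "amat \<sigma> y $ i $ j = inner (\<sigma> y $ i) (\<sigma> y $ j)"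
      by (simp add: amat_def matrix_matrix_mult_def transpose_def inner_vec_def)
    also have "\<bar>\<dots>\<bar> \<le> norm (\<sigma> y $ i) * norm (\<sigma> y $ j)" by (rule Cauchy_Schwarz_ineq2)
    also have "\<dots> \<le> S * S"
      using row by (intro mult_mono) (auto intro: order_trans[OF norm_ge_zero])
    finally show ?thesis by (simp add: power2_eq_square)
  qed
  have "\<bar>\<Sum>i\<in>UNIV. b y $ i * pd i f y\<bar> \<le> (\<Sum>i\<in>(UNIV::'J set). B * D)"
    unfolding abs_mult[symmetric] using f order_trans[OF component_le_norm_cart b]
    by (intro order_trans[OF sum_abs] sum_mono)
      (auto simp: abs_mult jet_le_def intro!: mult_mono order_trans[OF norm_ge_zero b])
  moreover have "\<bar>\<Sum>i\<in>UNIV. \<Sum>j\<in>UNIV. amat \<sigma> y $ i $ j * pd i (pd j f) y\<bar>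
      \<le> (\<Sum>i\<in>(UNIV::'J set). \<Sum>j\<in>(UNIV::'J set). S\<^sup>2 * D)"
    using f a
    by (intro order_trans[OF sum_abs] sum_mono) (auto simp: abs_mult jet_le_def intro!: mult_mono)
  ultimately show ?thesis
    unfolding Lgen_def by (simp add: algebra_simps abs_le_iff power2_eq_square)
qed

section \<open>Test functions from barriers\<close>

lemma C2c_if_compact_support:
  assumes "C2_on UNIV f" "\<And>y. f y \<noteq> 0 \<Longrightarrow> dist z y \<le> e"
  shows "C2c S f"
proof -
  have "{y \<in> S. f y \<noteq> 0} \<subseteq> cball z e" using assms(2) by auto
  then show ?thesis
    using assms(1) bounded_subset[OF bounded_cball] unfolding C2c_def C2_near_def by blast
qed

lemma C2c_imp_C2c_plus: "C2c S f \<Longrightarrow> C2c_plus S f"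
  unfolding C2c_plus_def by (intro exI[of _ f] exI[of _ 0]) auto

lemma C2b_if_jet_le:
  assumes "C2_on UNIV f" "\<And>y. jet_le D f y"
  shows "C2b S f"
  using assms unfolding C2b_def C2_near_def jet_le_def bounded_iff
  by (auto intro!: exI[of _ D] exI[of _ UNIV])

lemma zero_in_Hset: "(\<lambda>_. 0) \<in> Hset I \<phi> \<gamma> V"
proof -
  have "C2c_plus (closure (GG I \<phi>)) (\<lambda>_. 0)"
    by (intro C2c_imp_C2c_plus C2c_if_compact_support C2_on_const) auto
  moreover have "grad (\<lambda>_. 0) y = 0" for y :: "real^'a::finite"
    by (simp add: grad_def pd_const vec_eq_iff)
  ultimately show ?thesis
    unfolding Hset_def by (auto intro: exI[of _ 1])
qed

lemma dcone_inner_nonneg: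
  assumes "d \<in> dcone I \<phi> \<gamma> y" "\<And>i. i \<in> Idx I \<phi> y \<Longrightarrow> 0 \<le> inner u (\<gamma> i y)"
  shows "0 \<le> inner u d"
proof (cases "y \<in> frontier (GG I \<phi>)")
  case True
  then obtain s where "d = (\<Sum>i\<in>Idx I \<phi> y. s i *\<^sub>R \<gamma> i y)" "\<forall>i\<in>Idx I \<phi> y. 0 \<le> s i"
    using assms(1) by (auto simp: dcone_def)
  with assms(2) show ?thesis
    by (auto simp: inner_sum_right intro!: sum_nonneg)
next
  case False
  with assms(1) show ?thesis by (simp add: dcone_def)
qed

locale reflection_domain =
  fixes I :: "'i set" and \<phi> :: "'i \<Rightarrow> real^'J::finite \<Rightarrow> real"
    and \<gamma> :: "'i \<Rightarrow> real^'J \<Rightarrow> real^'J" and V :: "(real^'J) set"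
begin

abbreviation closed_domain :: "(real^'J) set" where
  "closed_domain \<equiv> closure (GG I \<phi>)"

definition bump_at :: "real \<Rightarrow> real \<Rightarrow> real^'J \<Rightarrow> (real^'J \<Rightarrow> real) \<Rightarrow> bool" where
  "bump_at \<epsilon> r y h \<longleftrightarrow> h \<in> Hset I \<phi> \<gamma> V \<and> C2_on UNIV h \<and> (\<forall>w. 0 \<le> h w) \<and> (\<forall>w. jet_le (1 / r) h w)
     \<and> (\<forall>w. h w \<noteq> 0 \<longrightarrow> dist y w \<le> \<epsilon>) \<and> (\<forall>w. dist y w < r \<longrightarrow> h w = 1)"

lemma bump_at_mono:
  assumes "bump_at \<epsilon> r y h" "0 < r'" "r' \<le> r"
  shows "bump_at \<epsilon> r' y h"
proof -
  have "1 / r \<le> 1 / r'" using assms(2,3) by (intro divide_left_mono) auto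
  with assms show ?thesis unfolding bump_at_def by (meson jet_le_mono order_less_le_trans)
qed

end

locale bump_cover =
  reflection_domain I \<phi> \<gamma> V + locally_finite_bumps A z h \<epsilon> "1 / r" M
  for I :: "'i set" and \<phi> :: "'i \<Rightarrow> real^'J::finite \<Rightarrow> real" and \<gamma> V A
    and z :: "nat \<Rightarrow> real^'J" and h \<epsilon> r M +
  assumes bump_at_center: "\<And>k. k \<in> A \<Longrightarrow> bump_at \<epsilon> r (z k) (h k)"
    and cover: "\<And>y. y \<in> closed_domain \<Longrightarrow> \<exists>k\<in>A. h k y = 1"
begin

lemma far_summand_in_Hset: "(\<lambda>y. if k \<in> far x then h k y else 0) \<in> Hset I \<phi> \<gamma> V"
  using bump_at_center[of k] far_subset[of x] zero_in_Hset[of I \<phi> \<gamma> V]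
  by (cases "k \<in> far x") (auto simp: bump_at_def)

lemma C2c_far_summand: "C2c S (\<lambda>y. if k \<in> far x then h k y else 0)"
  using C2_on_bumps[of k] bumps_support[of k] far_subset[of x]
  by (intro C2c_if_compact_support[of _ "z k" \<epsilon>])
    (cases "k \<in> far x"; auto simp: C2_on_const split: if_splits)+

end

context reflection_domain
begin

lemma bump_cover_exists:
  assumes r: "r > 0" and bumps: "\<And>y. y \<in> closed_domain \<Longrightarrow> \<exists>h. bump_at \<epsilon> r y h"
  shows "\<exists>A z h M. bump_cover I \<phi> \<gamma> V A z h \<epsilon> r M"
proof -
  obtain H where H: "\<And>y. y \<in> closed_domain \<Longrightarrow> bump_at \<epsilon> r y (H y)" using bumps by metis
  obtain A :: "nat set" and z :: "nat \<Rightarrow> real^'J" and M :: nat where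
    z: "\<And>k. k \<in> A \<Longrightarrow> z k \<in> closed_domain"
    and net: "\<And>y. y \<in> closed_domain \<Longrightarrow> \<exists>k\<in>A. dist (z k) y < r"
    and near: "\<And>y. finite {k\<in>A. dist (z k) y \<le> \<epsilon> + 1}" "\<And>y. card {k\<in>A. dist (z k) y \<le> \<epsilon> + 1} \<le> M"
    using locally_finite_net_exists[OF r, of closed_domain "\<epsilon> + 1"] by blast
  have h: "bump_at \<epsilon> r (z k) (H (z k))" if "k \<in> A" for k
    using H z that by blast
  have "bump_cover I \<phi> \<gamma> V A z (\<lambda>k. H (z k)) \<epsilon> r M"
  proof unfold_locales
    show "\<exists>k\<in>A. H (z k) y = 1" if "y \<in> closed_domain" for y
      using net[OF that] h by (auto simp: bump_at_def)
  qed (use h near r in \<open>auto simp: bump_at_def\<close>)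
  then show ?thesis by blast
qed

lemma AssumptionTF_if_uniform_bumps:
  fixes b :: "real^'J \<Rightarrow> real^'J" and \<sigma> :: "real^'J \<Rightarrow> real^'N::finite^'J"
  assumes bumps: "\<And>\<epsilon>. \<epsilon> > 0 \<Longrightarrow> \<exists>r>0. \<forall>y\<in>closed_domain. \<exists>h. bump_at \<epsilon> r y h"
    and bdd: "bounded (range b)" "bounded (range \<sigma>)"
  shows "AssumptionTF b \<sigma> I \<phi> \<gamma> V"
  unfolding AssumptionTF_def
proof (intro allI impI, goal_cases)
  case \<epsilon>: (1 \<epsilon> N)
  obtain r where r: "r > 0" "\<And>y. y \<in> closed_domain \<Longrightarrow> \<exists>h. bump_at \<epsilon> r y h"
    using bumps[OF \<epsilon>] by blast
  obtain A z h M where "bump_cover I \<phi> \<gamma> V A z h \<epsilon> r M"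
    using bump_cover_exists[OF r] by blast
  then interpret bump_cover I \<phi> \<gamma> V A z h \<epsilon> r M .
  obtain B S where B: "B > 0" "\<And>y. norm (b y) \<le> B" and S: "\<And>y. norm (\<sigma> y) \<le> S"
    using bdd unfolding bounded_pos by (metis rangeI)
  define C where "C = (real CARD('J) * B + 1/2 * (real CARD('J))\<^sup>2 * S\<^sup>2) * (real M * (1 / r))"
  have "0 \<le> C" using B(1) r(1) by (simp add: C_def)
  show ?case
  proof (rule exI[of _ far_sum], rule exI[of _ "C + 1"], rule exI[of _ "1 / 2"], intro conjI ballI impI)
    show "C + 1 > 0" "(1 / 2 :: real) > 0" using \<open>0 \<le> C\<close> by auto
    fix x
    show "C2b closed_domain (far_sum x)" by (rule C2b_if_jet_le[OF C2_on_far_sum jet_le_far_sum])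
    show "\<exists>h. (\<forall>k. h k \<in> Hset I \<phi> \<gamma> V \<and> C2c closed_domain (h k))
        \<and> (\<forall>y\<in>closed_domain. (\<lambda>k. h k y) sums far_sum x y)"
      using far_summand_in_Hset C2c_far_summand sums_far_sum
      by (intro exI[of _ "\<lambda>k y. if k \<in> far x then h k y else 0"]) blast
    fix y assume y: "y \<in> closed_domain"
    show "0 \<le> far_sum x y" by (rule far_sum_nonneg)
    show "far_sum x y = 0" if "norm (y - x) \<le> \<epsilon> / 2"
      using that by (intro far_sum_eq_0) (simp add: dist_norm norm_minus_commute)
    show "1 / 2 < far_sum x y" if "3 * \<epsilon> < norm (y - x)"
      using cover[OF y] bump_le_far_sum[of _ x y] that \<epsilon> by (force simp: dist_norm norm_minus_commute)
    show "\<bar>Lgen b \<sigma> (far_sum x) y\<bar> \<le> C + 1"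
      using abs_Lgen_le[of b y B \<sigma> S, OF B(2) S jet_le_far_sum[of x y]] by (simp add: C_def)
  qed
qed

definition barrier_at :: "real^'J \<Rightarrow> real \<Rightarrow> real \<Rightarrow> real^'J \<Rightarrow> bool" where
  "barrier_at n \<kappa> \<rho> z \<longleftrightarrow> V \<inter> cball z \<rho> \<subseteq> {z} \<and>
    (\<forall>y\<in>closed_domain \<inter> cball z \<rho>. (\<rho> / 2 \<le> dist z y \<longrightarrow> 2 \<le> barrier n \<kappa> (y - z))
      \<and> (\<forall>i\<in>Idx I \<phi> y. 0 \<le> inner (\<gamma> i y) (n + (2 * \<kappa>) *\<^sub>R (y - z))))"

lemma barrier_atI:
  assumes "V \<inter> cball z \<rho> \<subseteq> {z}"
    and "\<And>y. y \<in> closed_domain \<Longrightarrow> dist z y \<le> \<rho> \<Longrightarrow> \<rho> / 2 \<le> dist z y \<Longrightarrow> 2 \<le> barrier n \<kappa> (y - z)"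
    and "\<And>y i. y \<in> closed_domain \<Longrightarrow> dist z y \<le> \<rho> \<Longrightarrow> i \<in> Idx I \<phi> y \<Longrightarrow>
      0 \<le> inner (\<gamma> i y) (n + (2 * \<kappa>) *\<^sub>R (y - z))"
  shows "barrier_at n \<kappa> \<rho> z"
  using assms unfolding barrier_at_def by auto

lemma barrier_atD:
  assumes "barrier_at n \<kappa> \<rho> z"
  shows "V \<inter> cball z \<rho> \<subseteq> {z}"
    and "y \<in> closed_domain \<Longrightarrow> dist z y \<le> \<rho> \<Longrightarrow> \<rho> / 2 \<le> dist z y \<Longrightarrow> 2 \<le> barrier n \<kappa> (y - z)"
    and "y \<in> closed_domain \<Longrightarrow> dist z y \<le> \<rho> \<Longrightarrow> i \<in> Idx I \<phi> y \<Longrightarrow>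
      0 \<le> inner (\<gamma> i y) (n + (2 * \<kappa>) *\<^sub>R (y - z))"
  using assms unfolding barrier_at_def by auto

lemma bump_locally_constant_on_V:
  assumes \<rho>: "0 < \<rho>" and V: "V \<inter> cball z \<rho> \<subseteq> {z}" and x: "x \<in> V"
  shows "\<exists>\<delta>>0. \<exists>k. \<forall>y\<in>ball x \<delta>. bump n \<kappa> \<rho> (y - z) = k"
proof (cases "x = z")
  case True
  obtain r where r: "r > 0" "\<And>w. norm w < r \<Longrightarrow> bump n \<kappa> \<rho> w = 1"
    using bump_scale[OF \<rho>] by metis
  with True show ?thesis
    by (intro exI[of _ r] conjI exI[of _ 1]) (auto simp: dist_norm norm_minus_commute)
next
  case False
  then have far: "\<rho> < dist z x" using V x by force
  have "bump n \<kappa> \<rho> (y - z) = 0" if "y \<in> ball x (dist z x - \<rho>)" for y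
  proof (rule bump_eq_0[OF \<rho>])
    show "\<rho> \<le> norm (y - z)"
      using that dist_triangle[of z x y] by (simp add: dist_norm norm_minus_commute)
  qed
  then show ?thesis using far by (intro exI[of _ "dist z x - \<rho>"]) auto
qed

lemma translated_bump_in_Hset:
  assumes \<rho>: "0 < \<rho>" and barrier: "barrier_at n \<kappa> \<rho> z"
  shows "(\<lambda>y. bump n \<kappa> \<rho> (y - z)) \<in> Hset I \<phi> \<gamma> V"
  unfolding Hset_def
proof (intro CollectI conjI ballI)
  have "dist z y \<le> \<rho>" if "bump n \<kappa> \<rho> (y - z) \<noteq> 0" for y
    using bump_eq_0[OF \<rho>, of "y - z"] that by (force simp: dist_norm norm_minus_commute)
  moreover have "C2_on UNIV (\<lambda>y. bump n \<kappa> \<rho> (y - z))"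
    using C2_on_translate[OF C2_on_bump[OF open_UNIV]] by simp
  ultimately show "C2c_plus closed_domain (\<lambda>y. bump n \<kappa> \<rho> (y - z))"
    by (intro C2c_imp_C2c_plus C2c_if_compact_support)
  show "\<exists>\<delta>>0. \<exists>k. \<forall>y\<in>closed_domain \<inter> ball x \<delta>. bump n \<kappa> \<rho> (y - z) = k" if "x \<in> V" for x
    using bump_locally_constant_on_V[OF \<rho> barrier_atD(1)[OF barrier] that] by fast
  fix y d assume y: "y \<in> frontier (GG I \<phi>)" and d: "d \<in> dcone I \<phi> \<gamma> y"
  have y_closed: "y \<in> closed_domain" using y by (simp add: frontier_def)
  have "0 \<le> inner (- grad (bump n \<kappa> \<rho>) (y - z)) (\<gamma> i y)" if i: "i \<in> Idx I \<phi> y" for i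
  proof -
    have "inner (\<gamma> i y) (grad (bump n \<kappa> \<rho>) (y - z)) \<le> 0"
      using barrier_atD(2,3)[OF barrier y_closed] i
      by (intro inner_grad_bump_nonpos[OF \<rho>]) (auto simp: dist_norm norm_minus_commute)
    then show ?thesis by (simp add: inner_commute)
  qed
  then have "0 \<le> inner (- grad (bump n \<kappa> \<rho>) (y - z)) d"
    by (rule dcone_inner_nonneg[OF d])
  then show "inner d (grad (\<lambda>y. bump n \<kappa> \<rho> (y - z)) y) \<le> 0"
    by (simp add: grad_def pd_translate inner_commute)
qed

lemma bump_at_if_barrier_at:
  assumes \<rho>: "0 < \<rho>" "\<rho> \<le> \<epsilon> / 2"
  obtains r where "0 < r"
    "\<And>z y. barrier_at n \<kappa> \<rho> z \<Longrightarrow> dist z y < r \<Longrightarrow> bump_at \<epsilon> r y (\<lambda>w. bump n \<kappa> \<rho> (w - z))"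
proof -
  obtain r0 where r0: "0 < r0" "\<And>w. norm w < r0 \<Longrightarrow> bump n \<kappa> \<rho> w = 1"
    "\<And>w. jet_le (1 / r0) (bump n \<kappa> \<rho>) w"
    using bump_scale[OF \<rho>(1), of n \<kappa>] by blast
  define r where "r = min (r0 / 2) (\<epsilon> / 2)"
  have r: "0 < r" "r \<le> r0 / 2" "r \<le> \<epsilon> / 2" using r0(1) \<rho> by (auto simp: r_def)
  have r0_r: "1 / r0 \<le> 1 / r" using r r0(1) by (intro divide_left_mono) auto
  show ?thesis
  proof (rule that[OF r(1)])
    fix z y assume barrier: "barrier_at n \<kappa> \<rho> z" and zy: "dist z y < r"
    show "bump_at \<epsilon> r y (\<lambda>w. bump n \<kappa> \<rho> (w - z))"
      unfolding bump_at_def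
    proof (intro conjI allI impI)
      show "(\<lambda>w. bump n \<kappa> \<rho> (w - z)) \<in> Hset I \<phi> \<gamma> V"
        by (rule translated_bump_in_Hset[OF \<rho>(1) barrier])
      show "C2_on UNIV (\<lambda>w. bump n \<kappa> \<rho> (w - z))"
        using C2_on_translate[OF C2_on_bump[OF open_UNIV]] by simp
      fix w
      show "0 \<le> bump n \<kappa> \<rho> (w - z)" by (rule bump_nonneg)
      show "jet_le (1 / r) (\<lambda>w. bump n \<kappa> \<rho> (w - z)) w"
        unfolding jet_le_translate by (rule jet_le_mono[OF r0(3) r0_r])
      show "dist y w \<le> \<epsilon>" if "bump n \<kappa> \<rho> (w - z) \<noteq> 0"
      proof -
        have "dist z w < \<rho>"
          using bump_eq_0[OF \<rho>(1), of "w - z"] that by (force simp: dist_norm norm_minus_commute)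
        then show ?thesis using zy r(3) \<rho>(2) dist_triangle3[of y w z] by simp
      qed
      show "bump n \<kappa> \<rho> (w - z) = 1" if "dist y w < r"
      proof (rule r0(2))
        have "dist z w < r0" using that zy r(2) dist_triangle[of z w y] by simp
        then show "norm (w - z) < r0" by (simp add: dist_norm norm_minus_commute)
      qed
    qed
  qed
qed

definition barriers_along :: "real \<Rightarrow> (nat \<Rightarrow> real^'J) \<Rightarrow> bool" where
  "barriers_along \<epsilon> y \<longleftrightarrow> (\<exists>s x. strict_mono s \<and> (\<lambda>k. dist (x k) (y (s k))) \<longlonglongrightarrow> 0
     \<and> (\<exists>n \<kappa> \<rho>. 0 < \<rho> \<and> \<rho> \<le> \<epsilon> \<and> (\<forall>\<^sub>F k in sequentially. barrier_at n \<kappa> \<rho> (x k))))"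

lemma barriers_along_subseq:
  assumes "strict_mono t" "barriers_along \<epsilon> (y \<circ> t)"
  shows "barriers_along \<epsilon> y"
proof -
  obtain s x where s: "strict_mono s" and near: "(\<lambda>k. dist (x k) ((y \<circ> t) (s k))) \<longlonglongrightarrow> 0"
    and barriers: "\<exists>n \<kappa> \<rho>. 0 < \<rho> \<and> \<rho> \<le> \<epsilon> \<and> (\<forall>\<^sub>F k in sequentially. barrier_at n \<kappa> \<rho> (x k))"
    using assms(2) unfolding barriers_along_def by blast
  have "(\<lambda>k. dist (x k) (y ((t \<circ> s) k))) \<longlonglongrightarrow> 0" using near by simp
  with strict_mono_o[OF assms(1) s] barriers show ?thesis
    unfolding barriers_along_def by blast
qed

text \<open>Points needing ever smaller bumps would have barriers along a subsequence, and these all yield bumps of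
  one size.\<close>

lemma uniform_bumps_if_barriers_along:
  assumes barriers: "\<And>y \<epsilon>. 0 < \<epsilon> \<Longrightarrow> range y \<subseteq> closed_domain \<Longrightarrow> barriers_along \<epsilon> y" and \<epsilon>: "0 < \<epsilon>"
  shows "\<exists>r>0. \<forall>y\<in>closed_domain. \<exists>h. bump_at \<epsilon> r y h"
proof (rule ccontr)
  assume "\<not> ?thesis"
  then have "\<exists>y\<in>closed_domain. \<forall>h. \<not> bump_at \<epsilon> (inverse (real (Suc k))) y h" for k
    by (metis inverse_positive_iff_positive of_nat_0_less_iff zero_less_Suc)
  then obtain y where y: "range y \<subseteq> closed_domain"
    and no_bump: "\<And>k h. \<not> bump_at \<epsilon> (inverse (real (Suc k))) (y k) h"
    by (metis image_subsetI)
  obtain n \<kappa> \<rho> s x where \<rho>: "0 < \<rho>" "\<rho> \<le> \<epsilon> / 2" and s: "strict_mono s"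
    and near: "(\<lambda>k. dist (x k) (y (s k))) \<longlonglongrightarrow> 0"
    and barrier: "\<forall>\<^sub>F k in sequentially. barrier_at n \<kappa> \<rho> (x k)"
    using barriers[OF half_gt_zero[OF \<epsilon>] y] unfolding barriers_along_def by blast
  obtain r where r: "0 < r"
    "\<And>z y. barrier_at n \<kappa> \<rho> z \<Longrightarrow> dist z y < r \<Longrightarrow> bump_at \<epsilon> r y (\<lambda>w. bump n \<kappa> \<rho> (w - z))"
    using bump_at_if_barrier_at[OF \<rho>, of n \<kappa>] by blast
  have "\<forall>\<^sub>F k in sequentially. inverse (real (Suc (s k))) < r"
    using order_tendstoD(2)[OF LIMSEQ_inverse_real_of_nat r(1)] by (rule eventually_subseq[OF s])
  then have "\<forall>\<^sub>F k in sequentially. \<exists>h. bump_at \<epsilon> (inverse (real (Suc (s k)))) (y (s k)) h"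
    using order_tendstoD(2)[OF near r(1)] barrier
    by eventually_elim (metis bump_at_mono r(2) less_imp_le inverse_positive_iff_positive
        of_nat_0_less_iff zero_less_Suc)
  then show False
    using no_bump by simp
qed

lemma barrier_at_scaled:
  fixes m :: real
  assumes \<rho>: "0 < \<rho>" and \<kappa>: "0 \<le> \<kappa>" and pos: "0 < m + \<kappa> * (\<rho> / 2)" and V: "V \<inter> cball z \<rho> \<subseteq> {z}"
    and n: "\<And>y. y \<in> closed_domain \<Longrightarrow> dist z y \<le> \<rho> \<Longrightarrow> m * norm (y - z) \<le> inner n (y - z)"
    and \<gamma>: "\<And>y i. y \<in> closed_domain \<Longrightarrow> dist z y \<le> \<rho> \<Longrightarrow> i \<in> Idx I \<phi> y \<Longrightarrow>
        2 * \<kappa> * \<rho> * norm (\<gamma> i y) \<le> inner n (\<gamma> i y)"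
  shows "\<exists>n \<kappa>. barrier_at n \<kappa> \<rho> z"
proof (intro exI)
  define A where "A = 2 / ((m + \<kappa> * (\<rho> / 2)) * (\<rho> / 2))"
  have A: "0 < A" "A * ((m + \<kappa> * (\<rho> / 2)) * (\<rho> / 2)) = 2" using \<rho> pos by (auto simp: A_def)
  show "barrier_at (A *\<^sub>R n) (A * \<kappa>) \<rho> z"
  proof (rule barrier_atI[OF V])
    fix y assume y: "y \<in> closed_domain" "dist z y \<le> \<rho>"
    let ?w = "y - z"
    have w: "norm ?w = dist z y" by (simp add: dist_norm norm_minus_commute)
    show "2 \<le> barrier (A *\<^sub>R n) (A * \<kappa>) ?w" if "\<rho> / 2 \<le> dist z y"
    proof -
      have "(m + \<kappa> * (\<rho> / 2)) * (\<rho> / 2) \<le> barrier n \<kappa> ?w"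
        using \<rho> \<kappa> pos that n[OF y] by (intro barrier_ge_off_center) (auto simp: w)
      from mult_left_mono[OF this less_imp_le[OF A(1)]] show ?thesis
        unfolding barrier_scale A(2) .
    qed
    show "0 \<le> inner (\<gamma> i y) (A *\<^sub>R n + (2 * (A * \<kappa>)) *\<^sub>R ?w)" if i: "i \<in> Idx I \<phi> y" for i
    proof -
      have "\<bar>inner (\<gamma> i y) ?w\<bar> \<le> norm (\<gamma> i y) * \<rho>"
        using y(2) by (intro order_trans[OF Cauchy_Schwarz_ineq2] mult_left_mono) (auto simp: w)
      then have "2 * \<kappa> * - (norm (\<gamma> i y) * \<rho>) \<le> 2 * \<kappa> * inner (\<gamma> i y) ?w"
        using \<kappa> by (intro mult_left_mono) auto
      moreover have "2 * \<kappa> * - (norm (\<gamma> i y) * \<rho>) = - (2 * \<kappa> * \<rho> * norm (\<gamma> i y))" by simp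
      ultimately have "0 \<le> inner n (\<gamma> i y) + 2 * \<kappa> * inner (\<gamma> i y) ?w"
        using \<gamma>[OF y i] by linarith
      then have "0 \<le> A * (inner n (\<gamma> i y) + 2 * \<kappa> * inner (\<gamma> i y) ?w)"
        using A(1) by simp
      then show ?thesis by (simp add: inner_add_right inner_commute algebra_simps)
    qed
  qed
qed

lemma barrier_at_transfer:
  assumes barrier: "barrier_at n \<kappa> \<rho> z" and V: "V \<inter> cball z' \<rho> \<subseteq> {z'}"
    and domain: "\<And>w. norm w \<le> \<rho> \<Longrightarrow> z' + w \<in> closed_domain \<Longrightarrow> z + w \<in> closed_domain"
    and directions: "\<And>w i. norm w \<le> \<rho> \<Longrightarrow> i \<in> Idx I \<phi> (z' + w) \<Longrightarrow>
      i \<in> Idx I \<phi> (z + w) \<and> \<gamma> i (z' + w) = \<gamma> i (z + w)"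
  shows "barrier_at n \<kappa> \<rho> z'"
proof (rule barrier_atI[OF V])
  fix y assume y: "y \<in> closed_domain" "dist z' y \<le> \<rho>"
  let ?w = "y - z'"
  have w: "norm ?w \<le> \<rho>" "z + ?w \<in> closed_domain" "dist z (z + ?w) = dist z' y"
    using y domain[of ?w] by (simp_all add: dist_norm norm_minus_commute)
  show "2 \<le> barrier n \<kappa> ?w" if "\<rho> / 2 \<le> dist z' y"
    using barrier_atD(2)[OF barrier w(2)] that y(2) w(3) by simp
  show "0 \<le> inner (\<gamma> i y) (n + (2 * \<kappa>) *\<^sub>R ?w)" if "i \<in> Idx I \<phi> y" for i
    using barrier_atD(3)[OF barrier w(2), of i] directions[OF w(1), of i] that y(2) w(3) by simp
qed

end

section \<open>Barriers on piecewise smooth domains\<close>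

lemma finite_isolated_cball:
  fixes V :: "'a::metric_space set"
  assumes "finite V"
  obtains \<rho> where "\<rho> > 0" "V \<inter> cball z \<rho> \<subseteq> {z}"
proof -
  obtain d where "d > 0" "\<forall>x\<in>V. x \<noteq> z \<longrightarrow> d \<le> dist z x"
    using finite_set_avoid[OF assms] by blast
  then show ?thesis by (intro that[of "d / 2"]) force+
qed

lemma finite_positive_lower_bound:
  fixes f :: "'a \<Rightarrow> real"
  assumes "finite S" "\<And>i. i \<in> S \<Longrightarrow> 0 < f i"
  obtains c where "c > 0" "\<And>i. i \<in> S \<Longrightarrow> c \<le> f i"
  using assms by (intro that[of "Min (insert 1 (f ` S))"]) auto

lemma (in reflection_domain) barrier_at_vertex:
  assumes A2: "Assumption2' I \<phi> \<gamma> \<sigma> V" and z: "z \<in> V" and \<epsilon>: "\<epsilon> > 0"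
  shows "\<exists>n \<kappa> \<rho>. 0 < \<rho> \<and> \<rho> \<le> \<epsilon> \<and> barrier_at n \<kappa> \<rho> z"
proof -
  obtain v r \<alpha> where r: "r > 0" "\<alpha> > 0"
    and v: "\<And>y. y \<in> closed_domain \<inter> cball z r \<Longrightarrow> \<alpha> * norm (y - z) \<le> inner v (y - z)
         \<and> (\<forall>i\<in>Idx I \<phi> y. 0 \<le> inner (\<gamma> i y) v)"
    using A2 z unfolding Assumption2'_def by meson
  obtain \<rho>' where \<rho>': "\<rho>' > 0" "V \<inter> cball z \<rho>' \<subseteq> {z}"
    using finite_isolated_cball A2 unfolding Assumption2'_def by meson
  define \<rho> where "\<rho> = min \<epsilon> (min r \<rho>')"
  have \<rho>: "0 < \<rho>" "\<rho> \<le> \<epsilon>" "\<rho> \<le> r" "\<rho> \<le> \<rho>'" using r \<rho>' \<epsilon> by (auto simp: \<rho>_def)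
  have "\<exists>n \<kappa>. barrier_at n \<kappa> \<rho> z"
  proof (rule barrier_at_scaled[OF \<rho>(1), where \<kappa> = 0 and m = \<alpha> and n = v])
    show "V \<inter> cball z \<rho> \<subseteq> {z}" using \<rho>' \<rho> by auto
  qed (use r v \<rho> in \<open>auto simp: inner_commute\<close>)
  then show ?thesis using \<rho> by blast
qed

locale piecewise_C1_domain = reflection_domain +
  assumes pw_C1: "pw_C1_refl I \<phi> \<gamma>"
begin

lemma finite_I: "finite I"
  using pw_C1 by (simp add: pw_C1_refl_def)

lemma open_GG: "open (GG I \<phi>)"
  using pw_C1 by (simp add: pw_C1_refl_def)

lemma \<phi>_differentiable: "i \<in> I \<Longrightarrow> \<phi> i differentiable (at x)"
  using pw_C1 by (simp add: pw_C1_refl_def C1_fun_def)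

lemma continuous_on_\<phi>: "i \<in> I \<Longrightarrow> continuous_on S (\<phi> i)"
  by (simp add: \<phi>_differentiable continuous_at_imp_continuous_on differentiable_imp_continuous_within)

lemma frontier_Gi: "i \<in> I \<Longrightarrow> frontier (Gi \<phi> i) = {x. \<phi> i x = 0}"
  using pw_C1 by (simp add: pw_C1_refl_def)

lemma Idx_eq: "Idx I \<phi> x = {i\<in>I. \<phi> i x = 0}"
  using frontier_Gi by (auto simp: Idx_def)

lemma finite_Idx: "finite (Idx I \<phi> x)"
  using finite_I by (simp add: Idx_def)

lemma grad_\<phi>_nonzero: "i \<in> Idx I \<phi> x \<Longrightarrow> grad (\<phi> i) x \<noteq> 0"
  using pw_C1 by (auto simp: pw_C1_refl_def Idx_def)

lemma \<gamma>_nonzero: "i \<in> Idx I \<phi> x \<Longrightarrow> \<gamma> i x \<noteq> 0"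
  using pw_C1 by (force simp: pw_C1_refl_def Idx_def)

lemma continuous_on_\<gamma>: "i \<in> I \<Longrightarrow> continuous_on {x. \<phi> i x = 0} (\<gamma> i)"
  using pw_C1 frontier_Gi by (auto simp: pw_C1_refl_def)

lemma \<phi>_nonneg:
  assumes "i \<in> I" "y \<in> closed_domain"
  shows "0 \<le> \<phi> i y"
proof -
  have "closed {y. 0 \<le> \<phi> i y}"
    by (intro closed_Collect_le continuous_intros continuous_on_\<phi> assms(1))
  moreover have "GG I \<phi> \<subseteq> {y. 0 \<le> \<phi> i y}"
    using assms(1) by (force simp: GG_def Gi_def)
  ultimately show ?thesis using closure_minimal assms(2) by blast
qed

lemma \<gamma>_in_dcone:
  assumes "z \<in> frontier (GG I \<phi>)" "i \<in> Idx I \<phi> z"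
  shows "\<gamma> i z \<in> dcone I \<phi> \<gamma> z"
proof -
  have "\<gamma> i z = (\<Sum>j\<in>Idx I \<phi> z. (if j = i then 1 else 0) *\<^sub>R \<gamma> j z)"
    using assms(2) finite_Idx by (simp add: if_distrib[of "\<lambda>c. c *\<^sub>R _"] cong: if_cong)
  then show ?thesis
    using assms(1) unfolding dcone_def by (auto intro!: exI[of _ "\<lambda>j. if j = i then 1 else 0"])
qed

lemma positive_normal_exists:
  assumes z: "z \<in> closed_domain" "z \<notin> frontier (GG I \<phi>) - Uset I \<phi> \<gamma>"
  obtains s where "\<And>i. i \<in> Idx I \<phi> z \<Longrightarrow> 0 \<le> s i"
    "\<And>i. i \<in> Idx I \<phi> z \<Longrightarrow> 0 < inner (\<Sum>j\<in>Idx I \<phi> z. s j *\<^sub>R nrm \<phi> j z) (\<gamma> i z)"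
proof (cases "z \<in> frontier (GG I \<phi>)")
  case False
  then have "z \<in> GG I \<phi>"
    using z(1) open_GG by (simp add: frontier_def interior_open)
  then have "Idx I \<phi> z = {}" by (auto simp: Idx_eq GG_def Gi_def)
  then show ?thesis using that by simp
next
  case True
  with z(2) have "z \<in> Uset I \<phi> \<gamma>" by blast
  then obtain s where s: "\<forall>i\<in>Idx I \<phi> z. 0 \<le> s i"
    "\<forall>d\<in>dcone I \<phi> \<gamma> z - {0}. 0 < inner (\<Sum>j\<in>Idx I \<phi> z. s j *\<^sub>R nrm \<phi> j z) d"
    by (auto simp: Uset_def ncone_def)
  show ?thesis
    by (rule that[of s]) (use s \<gamma>_in_dcone[OF True] \<gamma>_nonzero in auto)
qed

lemma eventually_inner_nrm_ge:
  assumes i: "i \<in> Idx I \<phi> z" and e: "0 < e"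
  shows "\<forall>\<^sub>F y in nhds z. y \<in> closed_domain \<longrightarrow> - e * norm (y - z) \<le> inner (nrm \<phi> i z) (y - z)"
proof -
  let ?g = "grad (\<phi> i) z"
  have iI: "i \<in> I" and iz: "\<phi> i z = 0" using i by (auto simp: Idx_eq)
  have g: "0 < norm ?g" using grad_\<phi>_nonzero[OF i] by simp
  obtain d where d: "0 < d"
    "\<And>y. norm (y - z) < d \<Longrightarrow> norm (\<phi> i y - \<phi> i z - inner (y - z) ?g) \<le> e * norm ?g * norm (y - z)"
    using has_derivative_inner_grad[OF \<phi>_differentiable[OF iI], of z] mult_pos_pos[OF e g]
    unfolding has_derivative_at_alt by blast
  have "- e * norm (y - z) \<le> inner (nrm \<phi> i z) (y - z)" if "dist y z < d" "y \<in> closed_domain" for y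
  proof -
    have "- (e * norm ?g * norm (y - z)) \<le> inner ?g (y - z)"
      using d(2)[of y] \<phi>_nonneg[OF iI that(2)] that(1) iz
      by (simp add: dist_norm inner_commute abs_le_iff)
    then show ?thesis using g by (simp add: nrm_def field_simps)
  qed
  then show ?thesis unfolding eventually_nhds_metric using d(1) by blast
qed

lemma eventually_inner_normal_ge:
  assumes s: "\<And>i. i \<in> Idx I \<phi> z \<Longrightarrow> 0 \<le> s i" and e: "0 < e"
  shows "\<forall>\<^sub>F y in nhds z. y \<in> closed_domain \<longrightarrow>
    - e * norm (y - z) \<le> inner (\<Sum>j\<in>Idx I \<phi> z. s j *\<^sub>R nrm \<phi> j z) (y - z)"
proof -
  let ?J = "Idx I \<phi> z"
  define S where "S = 1 + (\<Sum>j\<in>?J. s j)"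
  have S: "0 < S" "(\<Sum>j\<in>?J. s j) \<le> S"
    using s by (auto simp: S_def intro!: add_pos_nonneg sum_nonneg)
  have "\<forall>\<^sub>F y in nhds z. \<forall>j\<in>?J. y \<in> closed_domain \<longrightarrow>
      - (e / S) * norm (y - z) \<le> inner (nrm \<phi> j z) (y - z)"
    using e S by (intro eventually_ball_finite finite_Idx ballI eventually_inner_nrm_ge) auto
  then show ?thesis
  proof (rule eventually_mono, intro impI)
    fix y assume "\<forall>j\<in>?J. y \<in> closed_domain \<longrightarrow> - (e / S) * norm (y - z) \<le> inner (nrm \<phi> j z) (y - z)"
      and "y \<in> closed_domain"
    then have face: "- (e / S) * norm (y - z) \<le> inner (nrm \<phi> j z) (y - z)" if "j \<in> ?J" for j
      using that by blast
    have "- e * norm (y - z) = S * (- (e / S) * norm (y - z))" using S(1) by simp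
    also have "\<dots> \<le> (\<Sum>j\<in>?J. s j) * (- (e / S) * norm (y - z))"
      using S e by (intro mult_right_mono_neg) (auto intro!: mult_nonpos_nonneg)
    also have "\<dots> \<le> (\<Sum>j\<in>?J. s j * inner (nrm \<phi> j z) (y - z))"
      unfolding sum_distrib_right by (intro sum_mono mult_left_mono face s)
    finally show "- e * norm (y - z) \<le> inner (\<Sum>j\<in>?J. s j *\<^sub>R nrm \<phi> j z) (y - z)"
      by (simp add: inner_sum_left)
  qed
qed

lemma eventually_Idx_subset: "\<forall>\<^sub>F y in nhds z. Idx I \<phi> y \<subseteq> Idx I \<phi> z"
proof -
  have "\<forall>\<^sub>F y in nhds z. \<forall>i\<in>I - Idx I \<phi> z. \<phi> i y \<noteq> 0"
  proof (intro eventually_ball_finite ballI)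
    fix i assume i: "i \<in> I - Idx I \<phi> z"
    have "open {y. \<phi> i y \<noteq> 0}"
      using i by (intro open_Collect_neq continuous_on_\<phi> continuous_on_const) auto
    then show "\<forall>\<^sub>F y in nhds z. \<phi> i y \<noteq> 0"
      using i eventually_nhds_in_open[of "{y. \<phi> i y \<noteq> 0}" z] by (simp add: Idx_eq)
  qed (use finite_I in auto)
  then show ?thesis by eventually_elim (auto simp: Idx_eq)
qed

lemma eventually_inner_reflection_ge:
  assumes n: "\<And>i. i \<in> Idx I \<phi> z \<Longrightarrow> 0 < inner n (\<gamma> i z)"
  obtains c where "0 < c"
    "\<forall>\<^sub>F y in nhds z. \<forall>i\<in>Idx I \<phi> y. c * norm (\<gamma> i y) \<le> inner n (\<gamma> i y)"
proof -
  obtain c where c: "0 < c"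
    "\<And>i. i \<in> Idx I \<phi> z \<Longrightarrow> c \<le> inner n (\<gamma> i z) / (2 * norm (\<gamma> i z))"
    using finite_positive_lower_bound[OF finite_Idx[of z], of "\<lambda>i. inner n (\<gamma> i z) / (2 * norm (\<gamma> i z))"]
      n \<gamma>_nonzero by auto
  have "\<forall>\<^sub>F y in nhds z. \<forall>i\<in>Idx I \<phi> z. \<phi> i y = 0 \<longrightarrow> c * norm (\<gamma> i y) \<le> inner n (\<gamma> i y)"
  proof (intro eventually_ball_finite ballI finite_Idx)
    fix i assume i: "i \<in> Idx I \<phi> z"
    let ?gap = "\<lambda>y. inner n (\<gamma> i y) - c * norm (\<gamma> i y)"
    have "0 < c * norm (\<gamma> i z)" "2 * (c * norm (\<gamma> i z)) \<le> inner n (\<gamma> i z)"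
      using c(1) c(2)[OF i] \<gamma>_nonzero[OF i] by (simp_all add: field_simps)
    then have gap: "0 < ?gap z" by linarith
    have "continuous_on {y. \<phi> i y = 0} ?gap"
      using i by (intro continuous_intros continuous_on_\<gamma>) (auto simp: Idx_eq)
    then have "(?gap \<longlongrightarrow> ?gap z) (at z within {y. \<phi> i y = 0})"
      using i by (simp add: continuous_on_def Idx_eq)
    from order_tendstoD(1)[OF this gap]
    have "\<forall>\<^sub>F y in nhds z. y \<noteq> z \<longrightarrow> \<phi> i y = 0 \<longrightarrow> 0 < ?gap y"
      by (simp add: eventually_at_filter)
    then show "\<forall>\<^sub>F y in nhds z. \<phi> i y = 0 \<longrightarrow> c * norm (\<gamma> i y) \<le> inner n (\<gamma> i y)"
      by eventually_elim (use gap in force)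
  qed
  then have "\<forall>\<^sub>F y in nhds z. \<forall>i\<in>Idx I \<phi> y. c * norm (\<gamma> i y) \<le> inner n (\<gamma> i y)"
    using eventually_Idx_subset[of z] by eventually_elim (auto simp: Idx_eq)
  with c(1) show ?thesis by (rule that)
qed

lemma barrier_at_nonvertex:
  assumes V: "finite V" "frontier (GG I \<phi>) - Uset I \<phi> \<gamma> \<subseteq> V"
    and z: "z \<in> closed_domain" "z \<notin> V" and \<epsilon>: "\<epsilon> > 0"
  shows "\<exists>n \<kappa> \<rho>. 0 < \<rho> \<and> \<rho> \<le> \<epsilon> \<and> barrier_at n \<kappa> \<rho> z"
proof -
  obtain s where s: "\<And>i. i \<in> Idx I \<phi> z \<Longrightarrow> 0 \<le> s i"
    "\<And>i. i \<in> Idx I \<phi> z \<Longrightarrow> 0 < inner (\<Sum>j\<in>Idx I \<phi> z. s j *\<^sub>R nrm \<phi> j z) (\<gamma> i z)"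
    using positive_normal_exists z V(2) by blast
  define n where "n = (\<Sum>j\<in>Idx I \<phi> z. s j *\<^sub>R nrm \<phi> j z)"
  obtain c where c: "0 < c"
    and reflection: "\<forall>\<^sub>F y in nhds z. \<forall>i\<in>Idx I \<phi> y. c * norm (\<gamma> i y) \<le> inner n (\<gamma> i y)"
    using eventually_inner_reflection_ge s(2) unfolding n_def by blast
  have "\<forall>\<^sub>F y in nhds z. y \<in> closed_domain \<longrightarrow> - (c / 8) * norm (y - z) \<le> inner n (y - z)"
    unfolding n_def using c by (intro eventually_inner_normal_ge s) auto
  from eventually_conj[OF this reflection] obtain d where d: "0 < d" and near: "\<And>y. dist y z < d \<Longrightarrow>
      (y \<in> closed_domain \<longrightarrow> - (c / 8) * norm (y - z) \<le> inner n (y - z)) \<and>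
      (\<forall>i\<in>Idx I \<phi> y. c * norm (\<gamma> i y) \<le> inner n (\<gamma> i y))"
    unfolding eventually_nhds_metric by blast
  obtain \<rho>' where \<rho>': "\<rho>' > 0" "V \<inter> cball z \<rho>' \<subseteq> {z}"
    using finite_isolated_cball[OF V(1)] by blast
  define \<rho> where "\<rho> = min \<epsilon> (min (d / 2) \<rho>')"
  have \<rho>: "0 < \<rho>" "\<rho> \<le> \<epsilon>" "\<rho> < d" "\<rho> \<le> \<rho>'" using d \<rho>' \<epsilon> by (auto simp: \<rho>_def)
  have "\<exists>n \<kappa>. barrier_at n \<kappa> \<rho> z"
  proof (rule barrier_at_scaled[OF \<rho>(1), where \<kappa> = "c / (2 * \<rho>)" and m = "- (c / 8)" and n = n])
    show "0 \<le> c / (2 * \<rho>)" "0 < - (c / 8) + c / (2 * \<rho>) * (\<rho> / 2)"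
      using c \<rho>(1) by (simp_all add: field_simps)
    show "V \<inter> cball z \<rho> \<subseteq> {z}" using \<rho>' \<rho> by auto
    fix y assume y: "y \<in> closed_domain" "dist z y \<le> \<rho>"
    then have "dist y z < d" using \<rho>(3) by (simp add: dist_commute)
    note near = near[OF this]
    show "- (c / 8) * norm (y - z) \<le> inner n (y - z)" using near y(1) by blast
    show "2 * (c / (2 * \<rho>)) * \<rho> * norm (\<gamma> i y) \<le> inner n (\<gamma> i y)" if "i \<in> Idx I \<phi> y" for i
      using near that \<rho>(1) by simp
  qed
  then show ?thesis using \<rho> by blast
qed

lemma barrier_exists:
  assumes A2: "Assumption2' I \<phi> \<gamma> \<sigma> V" and z: "z \<in> closed_domain" and \<epsilon>: "\<epsilon> > 0"
  shows "\<exists>n \<kappa> \<rho>. 0 < \<rho> \<and> \<rho> \<le> \<epsilon> \<and> barrier_at n \<kappa> \<rho> z"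
proof (cases "z \<in> V")
  case True
  then show ?thesis by (rule barrier_at_vertex[OF A2 _ \<epsilon>])
next
  case False
  then show ?thesis
    using A2 by (intro barrier_at_nonvertex z \<epsilon>) (simp_all add: Assumption2'_def)
qed

end

section \<open>Polyhedral domains\<close>

lemma nonneg_right_of_upcrossing_zero:
  fixes f f' :: "real \<Rightarrow> real"
  assumes f: "\<And>t. (f has_real_derivative f' t) (at t)" and up: "\<And>t. f t = 0 \<Longrightarrow> 0 < f' t"
    and a: "f a = 0" "a \<le> t"
  shows "0 \<le> f t"
proof (rule ccontr)
  assume neg: "\<not> 0 \<le> f t"
  have cont: "continuous_on S f" for S
    using f by (meson DERIV_isCont continuous_at_imp_continuous_on)
  let ?Z = "{s \<in> {a..t}. f s = 0}"
  have "?Z = {a..t} \<inter> {s. f s = 0}" by auto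
  moreover have "closed {s. f s = 0}" by (intro closed_Collect_eq cont continuous_on_const)
  ultimately have "compact ?Z" by (simp add: compact_Int_closed)
  moreover have "a \<in> ?Z" using a by simp
  ultimately obtain x where x: "x \<in> ?Z" and last: "\<And>y. y \<in> ?Z \<Longrightarrow> y \<le> x"
    using compact_attains_sup[of ?Z] by blast
  have "x < t" using x neg by (cases "x = t") auto
  obtain d where d: "0 < d" "\<And>h. 0 < h \<Longrightarrow> h < d \<Longrightarrow> f x < f (x + h)"
    using DERIV_pos_inc_right[OF f up] x by blast
  define h where "h = min (d / 2) (t - x)"
  have h: "0 < h" "h < d" "x + h \<le> t" using d(1) \<open>x < t\<close> by (auto simp: h_def min_def)
  have "0 < f (x + h)" using d(2)[OF h(1,2)] x by simp
  then obtain u where "x + h \<le> u" "u \<le> t" "f u = 0"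
    using IVT2'[of f t 0 "x + h"] neg h(3) cont by auto
  then show False using last[of u] x h(1) by auto
qed

lemma pos_right_of_upcrossing_zero:
  fixes f f' :: "real \<Rightarrow> real"
  assumes f: "\<And>t. (f has_real_derivative f' t) (at t)" and up: "\<And>t. f t = 0 \<Longrightarrow> 0 < f' t"
    and a: "f a = 0" "a < t"
  shows "0 < f t"
proof (rule ccontr)
  assume "\<not> 0 < f t"
  then have "f t = 0"
    using nonneg_right_of_upcrossing_zero[of f f' a t, OF f up] a by fastforce
  then obtain d where d: "0 < d" "\<And>h. 0 < h \<Longrightarrow> h < d \<Longrightarrow> f (t - h) < f t"
    using DERIV_pos_inc_left[OF f up] by blast
  define h where "h = min (d / 2) (t - a)"
  have "0 < h" "h < d" "a \<le> t - h" using d(1) a(2) by (auto simp: h_def min_def)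
  then show False
    using d(2)[of h] \<open>f t = 0\<close> nonneg_right_of_upcrossing_zero[of f f' a "t - h", OF f up a(1)] by simp
qed

lemma has_real_derivative_along_line:
  assumes "f differentiable (at (z + t *\<^sub>R u))"
  shows "((\<lambda>t. f (z + t *\<^sub>R u)) has_real_derivative inner u (grad f (z + t *\<^sub>R u))) (at t)"
proof -
  have "((\<lambda>t. z + t *\<^sub>R u) has_derivative (\<lambda>h. h *\<^sub>R u)) (at t)"
    by (auto intro!: derivative_eq_intros)
  from has_derivative_compose[OF this has_derivative_inner_grad[OF assms]] show ?thesis
    by (simp add: has_field_derivative_def mult.commute[of _ "inner u _"])
qed

lemma grad_minus:
  assumes "f differentiable (at x)"
  shows "grad (\<lambda>y. - f y) x = - grad f x"
proof -
  have "pd i (\<lambda>y. - f y) x = - pd i f x" for i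
    using pd_eqI[OF has_derivative_minus[OF assms[unfolded frechet_derivative_works]]] by (simp add: pd_def)
  then show ?thesis by (simp add: grad_def vec_eq_iff)
qed

lemma pos_above_constant_normal_level:
  fixes f :: "real^'J::finite \<Rightarrow> real"
  assumes f: "\<And>x. f differentiable (at x)"
    and normal: "\<And>x. f x = 0 \<Longrightarrow> \<exists>c>0. grad f x = c *\<^sub>R \<nu>"
    and z: "f z = 0" and y: "inner \<nu> z < inner \<nu> y"
  shows "0 < f y"
proof -
  have "0 < (\<lambda>t. f (z + t *\<^sub>R (y - z))) 1"
  proof (rule pos_right_of_upcrossing_zero[OF has_real_derivative_along_line[OF f]])
    show "f (z + 0 *\<^sub>R (y - z)) = 0" using z by simp
    fix t assume "f (z + t *\<^sub>R (y - z)) = 0"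
    then obtain c where "0 < c" "grad f (z + t *\<^sub>R (y - z)) = c *\<^sub>R \<nu>" using normal by blast
    then show "0 < inner (y - z) (grad f (z + t *\<^sub>R (y - z)))"
      using y by (simp add: inner_commute[of "y - z"] inner_diff_right)
  qed simp
  then show ?thesis by simp
qed

lemma nonneg_on_constant_normal_level:
  fixes f :: "real^'J::finite \<Rightarrow> real"
  assumes f: "\<And>x. f differentiable (at x)"
    and normal: "\<And>x. f x = 0 \<Longrightarrow> \<exists>c>0. grad f x = c *\<^sub>R \<nu>"
    and z: "f z = 0" and \<nu>: "\<nu> \<noteq> 0" and y: "inner \<nu> y = inner \<nu> z"
  shows "0 \<le> f y"
proof (rule tendsto_lowerbound)
  have "isCont (\<lambda>t. f (y + t *\<^sub>R \<nu>)) 0"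
    by (rule DERIV_isCont[OF has_real_derivative_along_line[OF f]])
  then show "((\<lambda>t. f (y + t *\<^sub>R \<nu>)) \<longlongrightarrow> f y) (at_right 0)"
    by (auto simp: isCont_def intro: tendsto_within_subset)
  show "\<forall>\<^sub>F t in at_right 0. 0 \<le> f (y + t *\<^sub>R \<nu>)"
    using eventually_at_right_less[of "0::real"]
    by eventually_elim (use y \<nu> in \<open>auto intro!: less_imp_le pos_above_constant_normal_level[OF f normal z]
        simp: inner_add_right\<close>)
qed simp

lemma sign_about_constant_normal_level:
  fixes f :: "real^'J::finite \<Rightarrow> real"
  assumes f: "\<And>x. f differentiable (at x)"
    and normal: "\<And>x. f x = 0 \<Longrightarrow> \<exists>c>0. grad f x = c *\<^sub>R \<nu>"
    and z: "f z = 0" and \<nu>: "\<nu> \<noteq> 0"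
  shows "0 < f y \<longleftrightarrow> inner \<nu> z < inner \<nu> y" "f y = 0 \<longleftrightarrow> inner \<nu> y = inner \<nu> z"
proof -
  have minus_f: "(\<lambda>x. - f x) differentiable (at x)" for x
    using f by simp
  have minus_normal: "\<exists>c>0. grad (\<lambda>x. - f x) x = c *\<^sub>R - \<nu>" if "- f x = 0" for x
    using normal[of x] that by (auto simp: grad_minus[OF f])
  note above = pos_above_constant_normal_level[OF f normal z, of y]
    and below = pos_above_constant_normal_level[OF minus_f minus_normal, of z y]
    and level = nonneg_on_constant_normal_level[OF f normal z \<nu>, of y]
      nonneg_on_constant_normal_level[OF minus_f minus_normal, of z y]
  show "0 < f y \<longleftrightarrow> inner \<nu> z < inner \<nu> y" "f y = 0 \<longleftrightarrow> inner \<nu> y = inner \<nu> z"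
    using above below level z \<nu> by fastforce+
qed

lemma closure_open_halfspaces:
  fixes \<nu> :: "'i \<Rightarrow> 'a::euclidean_space"
  assumes "\<And>i. i \<in> A \<Longrightarrow> \<nu> i \<noteq> 0" "{x. \<forall>i\<in>A. \<beta> i < inner (\<nu> i) x} \<noteq> {}"
  shows "closure {x. \<forall>i\<in>A. \<beta> i < inner (\<nu> i) x} = {x. \<forall>i\<in>A. \<beta> i \<le> inner (\<nu> i) x}"
proof -
  let ?H = "\<lambda>i. {x. \<beta> i < inner (\<nu> i) x}"
  have Inter: "{x. \<forall>i\<in>A. \<beta> i < inner (\<nu> i) x} = \<Inter>(?H ` A)" by auto
  have "closure (\<Inter>(?H ` A)) = \<Inter>(closure ` ?H ` A)"
    using assms(2) unfolding Inter
    by (subst closure_Inter_convex_open) (auto intro: convex_halfspace_gt open_halfspace_gt)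
  also have "\<dots> = {x. \<forall>i\<in>A. \<beta> i \<le> inner (\<nu> i) x}"
    using assms(1) by auto
  finally show ?thesis unfolding Inter .
qed

locale halfspace_domain = piecewise_C1_domain I \<phi> \<gamma> V
  for I :: "'i set" and \<phi> :: "'i \<Rightarrow> real^'J::finite \<Rightarrow> real" and \<gamma> V +
  fixes A :: "'i set" and \<nu> :: "'i \<Rightarrow> real^'J" and \<beta> :: "'i \<Rightarrow> real" and g :: "'i \<Rightarrow> real^'J"
  assumes finite_A: "finite A" and norm_\<nu>: "\<And>i. i \<in> A \<Longrightarrow> norm (\<nu> i) = 1"
    and closed_domain_iff: "\<And>x. x \<in> closed_domain \<longleftrightarrow> (\<forall>i\<in>A. \<beta> i \<le> inner (\<nu> i) x)"
    and Idx_eq_halfspaces: "\<And>x. Idx I \<phi> x = {i\<in>A. inner (\<nu> i) x = \<beta> i}"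
    and \<gamma>_eq: "\<And>i x. i \<in> Idx I \<phi> x \<Longrightarrow> \<gamma> i x = g i"

context piecewise_C1_domain
begin

lemma \<phi>_pos_if_no_zero:
  assumes "i \<in> I" "\<And>x. \<phi> i x \<noteq> 0"
  shows "0 < \<phi> i y"
proof -
  have "frontier (Gi \<phi> i) = {}" using frontier_Gi assms by simp
  moreover have "Gi \<phi> i \<noteq> {}" using pw_C1 assms(1) by (auto simp: pw_C1_refl_def GG_def)
  ultimately have "Gi \<phi> i = UNIV" using frontier_eq_empty by blast
  then show ?thesis by (auto simp: Gi_def)
qed

lemma constant_normal_halfspace:
  assumes i: "i \<in> I" and p: "\<phi> i p = 0" and \<nu>: "\<And>x. \<phi> i x = 0 \<Longrightarrow> nrm \<phi> i x = \<nu>"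
  shows "norm \<nu> = 1" "0 < \<phi> i y \<longleftrightarrow> inner \<nu> p < inner \<nu> y" "\<phi> i y = 0 \<longleftrightarrow> inner \<nu> y = inner \<nu> p"
proof -
  have grad: "0 < norm (grad (\<phi> i) x)" if "\<phi> i x = 0" for x
    using grad_\<phi>_nonzero[of i x] i that by (simp add: Idx_eq)
  show "norm \<nu> = 1" using \<nu>[OF p] grad[OF p] by (auto simp: nrm_def)
  then have "\<nu> \<noteq> 0" by auto
  moreover have "\<exists>c>0. grad (\<phi> i) x = c *\<^sub>R \<nu>" if "\<phi> i x = 0" for x
    using grad[OF that] \<nu>[OF that]
    by (intro exI[of _ "norm (grad (\<phi> i) x)"]) (auto simp: nrm_def)
  ultimately show "0 < \<phi> i y \<longleftrightarrow> inner \<nu> p < inner \<nu> y" "\<phi> i y = 0 \<longleftrightarrow> inner \<nu> y = inner \<nu> p"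
    using sign_about_constant_normal_level[OF \<phi>_differentiable[OF i] _ p] by blast+
qed

lemma halfspace_domain_if_polyhedral:
  assumes poly: "polyhedral_refl I \<phi> \<gamma>"
  shows "\<exists>A \<nu> \<beta> g. halfspace_domain I \<phi> \<gamma> A \<nu> \<beta> g"
proof -
  have "\<forall>i\<in>I. \<exists>\<nu>. \<forall>x. \<phi> i x = 0 \<longrightarrow> nrm \<phi> i x = \<nu>" "\<forall>i\<in>I. \<exists>g. \<forall>x. \<phi> i x = 0 \<longrightarrow> \<gamma> i x = g"
    using poly frontier_Gi by (auto simp: polyhedral_refl_def)
  then obtain \<nu> g where \<nu>: "\<And>i x. i \<in> I \<Longrightarrow> \<phi> i x = 0 \<Longrightarrow> nrm \<phi> i x = \<nu> i"
    and g: "\<And>i x. i \<in> I \<Longrightarrow> \<phi> i x = 0 \<Longrightarrow> \<gamma> i x = g i" by metis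
  define A where "A = {i\<in>I. \<exists>x. \<phi> i x = 0}"
  then have A: "i \<in> I" if "i \<in> A" for i using that by simp
  have "\<forall>i\<in>A. \<exists>x. \<phi> i x = 0" by (simp add: A_def)
  then obtain p where p: "\<And>i. i \<in> A \<Longrightarrow> \<phi> i (p i) = 0" by metis
  define \<beta> where "\<beta> i = inner (\<nu> i) (p i)" for i
  have halfspace: "norm (\<nu> i) = 1" "0 < \<phi> i y \<longleftrightarrow> \<beta> i < inner (\<nu> i) y"
    "\<phi> i y = 0 \<longleftrightarrow> inner (\<nu> i) y = \<beta> i" if "i \<in> A" for i y
    using constant_normal_halfspace[OF A[OF that] p[OF that] \<nu>[OF A[OF that]]] by (simp_all add: \<beta>_def)
  have GG: "GG I \<phi> = {x. \<forall>i\<in>A. \<beta> i < inner (\<nu> i) x}"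
    using halfspace(2) \<phi>_pos_if_no_zero by (fastforce simp: GG_def Gi_def A_def)
  have "halfspace_domain I \<phi> \<gamma> A \<nu> \<beta> g"
  proof unfold_locales
    show "finite A" using finite_I by (simp add: A_def)
    have "\<nu> i \<noteq> 0" if "i \<in> A" for i using halfspace(1)[OF that] by auto
    moreover have "GG I \<phi> \<noteq> {}" using pw_C1 by (simp add: pw_C1_refl_def)
    ultimately show "x \<in> closed_domain \<longleftrightarrow> (\<forall>i\<in>A. \<beta> i \<le> inner (\<nu> i) x)" for x
      unfolding GG using closure_open_halfspaces[of A \<nu> \<beta>] by simp
    show "Idx I \<phi> x = {i\<in>A. inner (\<nu> i) x = \<beta> i}" for x
      using halfspace(3) by (auto simp: Idx_eq A_def)
    show "\<gamma> i x = g i" if "i \<in> Idx I \<phi> x" for i x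
      using g that by (simp add: Idx_eq)
  qed (rule halfspace(1))
  then show ?thesis by blast
qed

end

context halfspace_domain
begin

definition slack :: "'i \<Rightarrow> real^'J \<Rightarrow> real" where
  "slack i x = inner (\<nu> i) x - \<beta> i"

definition inactive_slack_ge :: "real \<Rightarrow> real^'J \<Rightarrow> bool" where
  "inactive_slack_ge m x \<longleftrightarrow> (\<forall>i\<in>A - Idx I \<phi> x. m \<le> slack i x)"

lemma closed_domain_slack: "x \<in> closed_domain \<longleftrightarrow> (\<forall>i\<in>A. 0 \<le> slack i x)"
  by (simp add: closed_domain_iff slack_def)

lemma Idx_slack: "Idx I \<phi> x = {i\<in>A. slack i x = 0}"
  by (simp add: Idx_eq_halfspaces slack_def)

lemma slack_add: "slack i (x + w) = slack i x + inner (\<nu> i) w"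
  by (simp add: slack_def inner_add_right)

lemma slack_diff_le_dist: "i \<in> A \<Longrightarrow> slack i y - slack i x \<le> dist x y"
  using Cauchy_Schwarz_ineq2[of "\<nu> i" "y - x"] norm_\<nu>[of i]
  by (simp add: slack_def inner_diff_right dist_norm norm_minus_commute)

lemma inactive_slack_pos_nearby:
  assumes "inactive_slack_ge m x" "norm w < m" "i \<in> A - Idx I \<phi> x"
  shows "0 < slack i (x + w)"
  using assms slack_diff_le_dist[of i x "x + w"] unfolding inactive_slack_ge_def
  by (force simp: dist_norm)

lemma closed_domain_near_face:
  assumes "inactive_slack_ge m x" "norm w < m"
  shows "x + w \<in> closed_domain \<longleftrightarrow> (\<forall>i\<in>Idx I \<phi> x. 0 \<le> inner (\<nu> i) w)"
proof -
  have "x + w \<in> closed_domain \<longleftrightarrow> (\<forall>i\<in>Idx I \<phi> x. 0 \<le> slack i (x + w))"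
    using inactive_slack_pos_nearby[OF assms] unfolding closed_domain_slack
    by (auto simp: Idx_slack intro: less_imp_le)
  then show ?thesis by (simp add: slack_add Idx_slack)
qed

lemma Idx_near_face:
  assumes "inactive_slack_ge m x" "norm w < m"
  shows "Idx I \<phi> (x + w) = {i \<in> Idx I \<phi> x. inner (\<nu> i) w = 0}"
  using inactive_slack_pos_nearby[OF assms] by (force simp: Idx_slack slack_add)

lemma barrier_at_same_face:
  assumes barrier: "barrier_at n \<kappa> \<rho> x" and V: "V \<inter> cball x' \<rho> \<subseteq> {x'}"
    and face: "Idx I \<phi> x' = Idx I \<phi> x"
    and slacks: "inactive_slack_ge m x" "inactive_slack_ge m x'" and \<rho>: "\<rho> < m"
  shows "barrier_at n \<kappa> \<rho> x'"
proof (rule barrier_at_transfer[OF barrier V])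
  fix w :: "real^'J" assume "norm w \<le> \<rho>"
  then have w: "norm w < m" using \<rho> by simp
  note near = closed_domain_near_face[OF slacks(1) w] closed_domain_near_face[OF slacks(2) w]
    Idx_near_face[OF slacks(1) w] Idx_near_face[OF slacks(2) w]
  show "x + w \<in> closed_domain" if "x' + w \<in> closed_domain"
    using that by (simp add: near face)
  fix i assume i: "i \<in> Idx I \<phi> (x' + w)"
  then have "i \<in> Idx I \<phi> (x + w)" by (simp add: near face)
  with i show "i \<in> Idx I \<phi> (x + w) \<and> \<gamma> i (x' + w) = \<gamma> i (x + w)" by (simp add: \<gamma>_eq)
qed

end

section \<open>Barriers along sequences\<close>

lemma convergent_or_divergent_subseq:
  fixes a :: "nat \<Rightarrow> real"
  assumes lower: "\<And>k. L \<le> a k"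
  obtains r where "strict_mono r"
    "convergent (\<lambda>k. a (r k)) \<or> filterlim (\<lambda>k. a (r k)) at_top sequentially"
proof (cases "\<exists>B. infinite {k. a k \<le> B}")
  case True
  then obtain B where "infinite {k. a k \<le> B}" by blast
  then obtain r :: "nat \<Rightarrow> nat" where r: "strict_mono r" "\<And>k. a (r k) \<le> B"
    using infinite_enumerate by blast
  have "\<forall>k. (a \<circ> r) k \<in> {L..B}" using r(2) lower by simp
  then obtain l r' where r': "strict_mono r'" "((a \<circ> r) \<circ> r') \<longlonglongrightarrow> l"
    using compact_Icc[of L B] unfolding compact_def by blast
  then show ?thesis
    using that[OF strict_mono_o[OF r(1) r'(1)]] by (auto simp: convergent_def comp_def)
next
  case False
  have "\<forall>\<^sub>F k in sequentially. Z \<le> a k" for Z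
    using False unfolding cofinite_eq_sequentially[symmetric] eventually_cofinite
    by (metis (mono_tags, lifting) Collect_mono finite_subset nle_le)
  then have "filterlim a at_top sequentially" by (simp add: filterlim_at_top)
  then show ?thesis using that[OF strict_mono_id] by simp
qed

lemma convergent_or_divergent_subseq_finite:
  fixes a :: "'i \<Rightarrow> nat \<Rightarrow> real"
  assumes "finite S" "\<And>i k. i \<in> S \<Longrightarrow> L i \<le> a i k"
  shows "\<exists>s. strict_mono s \<and>
    (\<forall>i\<in>S. convergent (\<lambda>k. a i (s k)) \<or> filterlim (\<lambda>k. a i (s k)) at_top sequentially)"
  using assms
proof (induction S rule: finite_induct)
  case empty
  then show ?case using strict_mono_id by auto
next
  case (insert j S)
  then obtain s where s: "strict_mono s"
    and S: "\<forall>i\<in>S. convergent (\<lambda>k. a i (s k)) \<or> filterlim (\<lambda>k. a i (s k)) at_top sequentially"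
    by blast
  obtain r where r: "strict_mono r"
    "convergent (\<lambda>k. a j (s (r k))) \<or> filterlim (\<lambda>k. a j (s (r k))) at_top sequentially"
    using convergent_or_divergent_subseq[of "L j" "\<lambda>k. a j (s k)"] insert.prems by auto
  have "convergent (\<lambda>k. a i (s (r k))) \<or> filterlim (\<lambda>k. a i (s (r k))) at_top sequentially"
    if "i \<in> S" for i
    using S that convergent_subseq_convergent[OF _ r(1), of "\<lambda>k. a i (s k)"]
      filterlim_compose[OF _ filterlim_subseq[OF r(1)], of "\<lambda>k. a i (s k)" at_top]
    by (auto simp: comp_def)
  with r(2) strict_mono_o[OF s r(1), unfolded comp_def] show ?case
    by (intro exI[of _ "\<lambda>k. s (r k)"]) simp
qed

lemma convergent_inner_span:
  fixes y :: "nat \<Rightarrow> 'a::real_inner"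
  assumes "\<And>w. w \<in> W \<Longrightarrow> convergent (\<lambda>k. inner w (y k))" "w \<in> span W"
  shows "convergent (\<lambda>k. inner w (y k))"
  using assms(2)
proof (induction rule: span_induct_alt)
  case base
  then show ?case by (simp add: convergent_const)
next
  case (step c w v)
  then show ?case
    by (simp add: inner_add_left convergent_add convergent_mult convergent_const assms(1))
qed

lemma constant_inner_span:
  assumes "\<And>w. w \<in> W \<Longrightarrow> \<exists>c. \<forall>k. inner w (x k) = c" "w \<in> span W"
  shows "\<exists>c. \<forall>k. inner w (x k) = c"
  using assms(2)
proof (induction rule: span_induct_alt)
  case base
  then show ?case by simp
next
  case (step a w v)
  then obtain c d where "\<forall>k. inner w (x k) = c" "\<forall>k. inner v (x k) = d"
    using assms(1) by blast
  then show ?case by (intro exI[of _ "a * c + d"]) (simp add: inner_add_left)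
qed

lemma inner_orthonormal_sum:
  assumes "finite B" "pairwise orthogonal B" "\<And>b. b \<in> B \<Longrightarrow> norm b = 1" "b \<in> B"
  shows "inner b (\<Sum>b'\<in>B. a b' *\<^sub>R b') = a b"
proof -
  have "inner b (\<Sum>b'\<in>B. a b' *\<^sub>R b') = (\<Sum>b'\<in>B. if b' = b then a b else 0)"
    unfolding inner_sum_right using assms(2,3,4)
    by (intro sum.cong) (auto simp: pairwise_def orthogonal_def norm_eq_1)
  then show ?thesis using assms(1,4) by simp
qed

text \<open>Cancel the vanishing fluctuations of the coordinates along an orthonormal basis of the span of \<open>W\<close>.\<close>

lemma vanishing_correction:
  fixes y :: "nat \<Rightarrow> 'a::euclidean_space"
  assumes conv: "\<And>w. w \<in> W \<Longrightarrow> convergent (\<lambda>k. inner w (y k))"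
  obtains e where "e \<longlonglongrightarrow> 0" "\<And>w. w \<in> W \<Longrightarrow> \<exists>c. \<forall>k. inner w (y k + e k) = c"
proof -
  obtain l where l: "\<And>w. w \<in> span W \<Longrightarrow> (\<lambda>k. inner w (y k)) \<longlonglongrightarrow> l w"
    using convergent_inner_span[OF conv] unfolding convergent_def by metis
  obtain B where B: "B \<subseteq> span W" "pairwise orthogonal B" "\<And>b. b \<in> B \<Longrightarrow> norm b = 1"
    "independent B" "span B = span W"
    using orthonormal_basis_subspace[OF subspace_span[of W]] by metis
  define e where "e k = (\<Sum>b\<in>B. (l b - inner b (y k)) *\<^sub>R b)" for k
  show ?thesis
  proof (rule that)
    show "e \<longlonglongrightarrow> 0"
      unfolding e_def[abs_def]
    proof (rule tendsto_null_sum)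
      fix b assume "b \<in> B"
      then have "(\<lambda>k. l b - inner b (y k)) \<longlonglongrightarrow> 0"
        using tendsto_diff[OF tendsto_const l[of b], of "l b"] B(1) by auto
      from tendsto_scaleR[OF this tendsto_const] show "(\<lambda>k. (l b - inner b (y k)) *\<^sub>R b) \<longlonglongrightarrow> 0"
        by simp
    qed
    have basis: "\<exists>c. \<forall>k. inner b (y k + e k) = c" if "b \<in> B" for b
    proof (intro exI allI)
      show "inner b (y k + e k) = l b" for k
        using inner_orthonormal_sum[OF finiteI_independent[OF B(4)] B(2,3) that]
        by (simp add: e_def inner_add_right)
    qed
    show "\<exists>c. \<forall>k. inner w (y k + e k) = c" if "w \<in> W" for w
    proof (rule constant_inner_span[OF basis])
      show "w \<in> span B" unfolding B(5) by (rule span_base[OF that])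
    qed
  qed
qed

lemma eventually_dist_gt_if_unbounded:
  fixes x y :: "nat \<Rightarrow> 'a::real_normed_vector"
  assumes unbounded: "filterlim (\<lambda>k. norm (y k)) at_top sequentially"
    and near: "(\<lambda>k. dist (x k) (y k)) \<longlonglongrightarrow> 0"
  shows "\<forall>\<^sub>F k in sequentially. r < dist (x k) v"
proof -
  have "\<forall>\<^sub>F k in sequentially. norm v + r + 1 < norm (y k)"
    using unbounded by (simp add: filterlim_at_top_dense)
  then show ?thesis
    using order_tendstoD(2)[OF near zero_less_one]
  proof eventually_elim
    case (elim k)
    then show ?case
      using dist_triangle3[of "y k" v "x k"] norm_triangle_sub[of "y k" v]
      by (simp add: dist_norm)
  qed
qed

context halfspace_domain
begin

lemma slack_at_top_if_close:
  assumes i: "i \<in> A" and near: "(\<lambda>k. dist (x k) (y k)) \<longlonglongrightarrow> 0"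
    and y: "filterlim (\<lambda>k. slack i (y k)) at_top sequentially"
  shows "filterlim (\<lambda>k. slack i (x k)) at_top sequentially"
proof (rule filterlim_at_top_mono)
  show "filterlim (\<lambda>k. - dist (x k) (y k) + slack i (y k)) at_top sequentially"
    by (rule filterlim_tendsto_add_at_top[OF tendsto_minus[OF near] y])
  show "\<forall>\<^sub>F k in sequentially. - dist (x k) (y k) + slack i (y k) \<le> slack i (x k)"
    using slack_diff_le_dist[OF i, of "y _" "x _"] by (intro always_eventually allI) (simp add: algebra_simps)
qed

lemma constant_slack_nonneg_if_close:
  assumes i: "i \<in> A" and near: "(\<lambda>k. dist (x k) (y k)) \<longlonglongrightarrow> 0"
    and y: "\<And>k. 0 \<le> slack i (y k)" and const: "\<And>k. slack i (x k) = l"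
  shows "0 \<le> l"
proof (rule LIMSEQ_le_const)
  show "(\<lambda>k. l + dist (x k) (y k)) \<longlonglongrightarrow> l"
    using tendsto_add[OF tendsto_const near, of l] by simp
  have "0 \<le> l + dist (x k) (y k)" for k
    using slack_diff_le_dist[OF i, of "y k" "x k"] y[of k] const[of k] by linarith
  then show "\<exists>N. \<forall>k\<ge>N. 0 \<le> l + dist (x k) (y k)" by blast
qed

lemma stabilized_slacks:
  fixes y :: "nat \<Rightarrow> real^'J"
  assumes y: "range y \<subseteq> closed_domain"
  obtains s x where "strict_mono s" "(\<lambda>k. dist (x k) (y (s k))) \<longlonglongrightarrow> 0"
    "\<And>i. i \<in> A \<Longrightarrow> (\<exists>l\<ge>0. \<forall>k. slack i (x k) = l) \<or> filterlim (\<lambda>k. slack i (x k)) at_top sequentially"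
proof -
  have slack_y: "0 \<le> slack i (y k)" if "i \<in> A" for i k
    using subsetD[OF y rangeI, of k] that by (simp add: closed_domain_slack)
  then obtain s where s: "strict_mono s" and dichotomy: "\<And>i. i \<in> A \<Longrightarrow>
      convergent (\<lambda>k. slack i (y (s k))) \<or> filterlim (\<lambda>k. slack i (y (s k))) at_top sequentially"
    using convergent_or_divergent_subseq_finite[OF finite_A, of "\<lambda>_. 0" "\<lambda>i k. slack i (y k)"]
    by auto
  define C where "C = {i\<in>A. convergent (\<lambda>k. slack i (y (s k)))}"
  have "convergent (\<lambda>k. inner (\<nu> i) (y (s k)))" if "i \<in> C" for i
  proof -
    have "convergent (\<lambda>k. slack i (y (s k)) + \<beta> i)"
      using that by (intro convergent_add convergent_const) (simp add: C_def)
    then show ?thesis by (simp add: slack_def)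
  qed
  then obtain e where e: "e \<longlonglongrightarrow> 0"
    and const: "\<And>w. w \<in> \<nu> ` C \<Longrightarrow> \<exists>c. \<forall>k. inner w (y (s k) + e k) = c"
    using vanishing_correction[of "\<nu> ` C" "\<lambda>k. y (s k)"] by blast
  define x where "x k = y (s k) + e k" for k
  have near: "(\<lambda>k. dist (x k) (y (s k))) \<longlonglongrightarrow> 0"
    using tendsto_norm_zero[OF e] by (simp add: x_def dist_norm)
  show ?thesis
  proof (rule that[OF s near])
    fix i assume i: "i \<in> A"
    show "(\<exists>l\<ge>0. \<forall>k. slack i (x k) = l) \<or> filterlim (\<lambda>k. slack i (x k)) at_top sequentially"
    proof (cases "i \<in> C")
      case True
      then obtain c where "\<And>k. slack i (x k) = c - \<beta> i"
        using const[of "\<nu> i"] by (auto simp: slack_def x_def)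
      then show ?thesis
        using constant_slack_nonneg_if_close[OF i near slack_y[OF i]] by blast
    next
      case False
      then show ?thesis
        using dichotomy[OF i] slack_at_top_if_close[OF i near] i by (auto simp: C_def)
    qed
  qed
qed

lemma eventually_same_face:
  assumes stable: "\<And>i. i \<in> A \<Longrightarrow>
      (\<exists>l\<ge>0. \<forall>k. slack i (x k) = l) \<or> filterlim (\<lambda>k. slack i (x k)) at_top sequentially"
  obtains J m where "0 < m"
    "\<forall>\<^sub>F k in sequentially. x k \<in> closed_domain \<and> Idx I \<phi> (x k) = J \<and> inactive_slack_ge m (x k)"
proof -
  define J where "J = {i\<in>A. \<forall>k. slack i (x k) = 0}"
  have "\<exists>m>0. \<forall>\<^sub>F k in sequentially. m \<le> slack i (x k)" if i: "i \<in> A - J" for i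
  proof (cases "filterlim (\<lambda>k. slack i (x k)) at_top sequentially")
    case True
    then show ?thesis by (intro exI[of _ 1]) (simp add: filterlim_at_top)
  next
    case False
    then obtain l where "0 \<le> l" "\<forall>k. slack i (x k) = l" using stable[of i] i by blast
    with i show ?thesis by (intro exI[of _ l]) (auto simp: J_def)
  qed
  then obtain \<mu> where \<mu>: "\<And>i. i \<in> A - J \<Longrightarrow> 0 < \<mu> i"
    "\<And>i. i \<in> A - J \<Longrightarrow> \<forall>\<^sub>F k in sequentially. \<mu> i \<le> slack i (x k)" by metis
  obtain m where m: "0 < m" "\<And>i. i \<in> A - J \<Longrightarrow> m \<le> \<mu> i"
    using finite_positive_lower_bound[of "A - J" \<mu>] \<mu>(1) finite_A by blast
  have "\<forall>\<^sub>F k in sequentially. \<forall>i\<in>A - J. m \<le> slack i (x k)"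
    using \<mu>(2) m(2) finite_A
    by (intro eventually_ball_finite ballI) (auto intro: eventually_mono order_trans)
  then have "\<forall>\<^sub>F k in sequentially. x k \<in> closed_domain \<and> Idx I \<phi> (x k) = J \<and> inactive_slack_ge m (x k)"
  proof eventually_elim
    case (elim k)
    have pos: "0 < slack i (x k)" if "i \<in> A - J" for i
      using elim m(1) that by force
    then have "Idx I \<phi> (x k) = J" by (force simp: Idx_slack J_def)
    moreover have "0 \<le> slack i (x k)" if "i \<in> A" for i
      using pos[of i] that by (cases "i \<in> J") (auto simp: J_def)
    then have "x k \<in> closed_domain" by (simp add: closed_domain_slack)
    ultimately show ?case using elim by (simp add: inactive_slack_ge_def)
  qed
  with m(1) show ?thesis by (rule that)
qed

lemma barriers_along_unbounded:
  assumes V: "finite V" "frontier (GG I \<phi>) - Uset I \<phi> \<gamma> \<subseteq> V" and \<epsilon>: "0 < \<epsilon>"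
    and y: "range y \<subseteq> closed_domain" and unbounded: "filterlim (\<lambda>k. norm (y k)) at_top sequentially"
  shows "barriers_along \<epsilon> y"
proof -
  obtain s x where s: "strict_mono s" and near: "(\<lambda>k. dist (x k) (y (s k))) \<longlonglongrightarrow> 0"
    and stable: "\<And>i. i \<in> A \<Longrightarrow>
      (\<exists>l\<ge>0. \<forall>k. slack i (x k) = l) \<or> filterlim (\<lambda>k. slack i (x k)) at_top sequentially"
    using stabilized_slacks[OF y] by blast
  obtain J m where m: "0 < m" and face:
    "\<forall>\<^sub>F k in sequentially. x k \<in> closed_domain \<and> Idx I \<phi> (x k) = J \<and> inactive_slack_ge m (x k)"
    using eventually_same_face[OF stable] by blast
  have "filterlim (\<lambda>k. norm (y (s k))) at_top sequentially"
    by (rule filterlim_compose[OF unbounded filterlim_subseq[OF s]])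
  then have "\<forall>\<^sub>F k in sequentially. \<forall>v\<in>V. 1 < dist (x k) v"
    by (intro eventually_ball_finite ballI V(1) eventually_dist_gt_if_unbounded[OF _ near])
  from eventually_conj[OF face this] obtain K where
    K: "\<And>k. k \<ge> K \<Longrightarrow> (x k \<in> closed_domain \<and> Idx I \<phi> (x k) = J \<and> inactive_slack_ge m (x k))
      \<and> (\<forall>v\<in>V. 1 < dist (x k) v)"
    unfolding eventually_sequentially by blast
  have "x K \<in> closed_domain" "x K \<notin> V" "0 < min \<epsilon> (min 1 (m / 2))"
    using K[of K] m \<epsilon> by (auto dest: bspec[of _ _ "x K"])
  then obtain n \<kappa> \<rho> where \<rho>: "0 < \<rho>" "\<rho> \<le> min \<epsilon> (min 1 (m / 2))" and barrier: "barrier_at n \<kappa> \<rho> (x K)"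
    using barrier_at_nonvertex[OF V] by blast
  have "barrier_at n \<kappa> \<rho> (x k)" if "k \<ge> K" for k
  proof (rule barrier_at_same_face[OF barrier])
    show "V \<inter> cball (x k) \<rho> \<subseteq> {x k}" using K[OF that] \<rho>(2) by force
  qed (use K[OF that] K[of K] \<rho> m in auto)
  then have "\<forall>\<^sub>F k in sequentially. barrier_at n \<kappa> \<rho> (x k)"
    unfolding eventually_sequentially by blast
  moreover have "\<rho> \<le> \<epsilon>" using \<rho>(2) by simp
  ultimately show ?thesis
    unfolding barriers_along_def using s near \<rho>(1) by blast
qed

end

context piecewise_C1_domain
begin

lemma barriers_along_bounded:
  assumes A2: "Assumption2' I \<phi> \<gamma> \<sigma> V" and \<epsilon>: "0 < \<epsilon>"
    and y: "range y \<subseteq> closed_domain" and bounded: "bounded (range y)"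
  shows "barriers_along \<epsilon> y"
proof -
  obtain z s where s: "strict_mono s" and lim: "(y \<circ> s) \<longlonglongrightarrow> z"
    using bounded_imp_convergent_subsequence[OF bounded] by blast
  have "z \<in> closed_domain"
    using closed_sequentially[OF closed_closure _ lim] y by auto
  then have "\<exists>n \<kappa> \<rho>. 0 < \<rho> \<and> \<rho> \<le> \<epsilon> \<and> (\<forall>\<^sub>F k in sequentially. barrier_at n \<kappa> \<rho> z)"
    using barrier_exists[OF A2 _ \<epsilon>] by simp
  moreover have "(\<lambda>k. dist z (y (s k))) \<longlonglongrightarrow> 0"
    using tendsto_dist[OF tendsto_const lim, of z] by (simp add: comp_def)
  ultimately show ?thesis
    unfolding barriers_along_def using s by (intro exI[of _ s] exI[of _ "\<lambda>_. z"]) blast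
qed

lemma barriers_along_closed_domain:
  assumes dom: "bounded (GG I \<phi>) \<or> polyhedral_refl I \<phi> \<gamma>"
    and A2: "Assumption2' I \<phi> \<gamma> \<sigma> V" and \<epsilon>: "0 < \<epsilon>" and y: "range y \<subseteq> closed_domain"
  shows "barriers_along \<epsilon> y"
proof -
  obtain s where s: "strict_mono s"
    "convergent (\<lambda>k. norm (y (s k))) \<or> filterlim (\<lambda>k. norm (y (s k))) at_top sequentially"
    using convergent_or_divergent_subseq[of 0 "\<lambda>k. norm (y k)"] by (auto simp: comp_def)
  have ys: "range (y \<circ> s) \<subseteq> closed_domain" using y by auto
  have "barriers_along \<epsilon> (y \<circ> s)"
  proof (cases "bounded (range (y \<circ> s))")
    case True
    then show ?thesis by (rule barriers_along_bounded[OF A2 \<epsilon> ys])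
  next
    case False
    then have "\<not> bounded (GG I \<phi>)" using ys bounded_closure bounded_subset by blast
    then obtain A \<nu> \<beta> g where "halfspace_domain I \<phi> \<gamma> A \<nu> \<beta> g"
      using dom halfspace_domain_if_polyhedral by blast
    then interpret halfspace_domain I \<phi> \<gamma> V A \<nu> \<beta> g .
    have "\<not> convergent (\<lambda>k. norm (y (s k)))"
      using False convergent_imp_bounded[of "\<lambda>k. norm (y (s k))"]
      by (auto simp: bounded_norm_comp comp_def convergent_def)
    with s(2) show ?thesis
      using A2 by (intro barriers_along_unbounded \<epsilon> ys) (auto simp: Assumption2'_def)
  qed
  then show ?thesis by (rule barriers_along_subseq[OF s(1)])
qed

end

lemma AssumptionV_if_Assumption2':
  assumes A2: "Assumption2' I \<phi> \<gamma> \<sigma> V"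
  shows "AssumptionV \<sigma> I \<phi> \<gamma> V"
  unfolding AssumptionV_def
proof (intro conjI ballI)
  show "finite V" using A2 by (simp add: Assumption2'_def)
  fix x assume "x \<in> V"
  then obtain v r \<alpha> where v: "norm v = 1" "r > 0" "\<alpha> > 0"
    "\<And>y. y \<in> closure (GG I \<phi>) \<inter> cball x r \<Longrightarrow> \<alpha> * norm (y - x) \<le> inner v (y - x)
         \<and> (\<forall>i\<in>Idx I \<phi> y. 0 \<le> inner (\<gamma> i y) v)"
    "\<And>y. y \<in> cball x r \<Longrightarrow> \<alpha> \<le> inner v (amat \<sigma> y *v v)"
    using A2 unfolding Assumption2'_def by meson
  have "0 \<le> inner v d" if "y \<in> closure (GG I \<phi>) \<inter> cball x r" "d \<in> dcone I \<phi> \<gamma> y" for y d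
    using dcone_inner_nonneg[OF that(2), of v] v(4)[OF that(1)] by (simp add: inner_commute)
  with v show "\<exists>v \<alpha> r. norm v = 1 \<and> \<alpha> > 0 \<and> r > 0 \<and>
       (\<forall>y\<in>closure (GG I \<phi>) \<inter> cball x r.
           inner v (y - x) \<ge> \<alpha> * norm (y - x)
         \<and> inner v (amat \<sigma> y *v v) \<ge> \<alpha>
         \<and> (\<forall>d\<in>dcone I \<phi> \<gamma> y. inner v d \<ge> 0))"
    by (intro exI[of _ v] exI[of _ \<alpha>] exI[of _ r]) auto
qed

theorem theorem3p5:
  fixes I :: "'i set"
    and \<phi> :: "'i \<Rightarrow> real^'J::finite \<Rightarrow> real"
    and \<gamma> :: "'i \<Rightarrow> real^'J \<Rightarrow> real^'J"
    and b :: "real^'J \<Rightarrow> real^'J"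
    and \<sigma> :: "real^'J \<Rightarrow> real^'N::finite^'J"
    and V :: "(real^'J) set"
  assumes dom: "(pw_C1_refl I \<phi> \<gamma> \<and> bounded (GG I \<phi>)) \<or> polyhedral_refl I \<phi> \<gamma>"
    and V_sub: "V \<subseteq> frontier (GG I \<phi>)"
    and A2: "Assumption2' I \<phi> \<gamma> \<sigma> V"
    and b_cont: "continuous_on UNIV b" and b_bdd: "bounded (range b)"
    and \<sigma>_cont: "continuous_on UNIV \<sigma>" and \<sigma>_bdd: "bounded (range \<sigma>)"
  shows "AssumptionTF b \<sigma> I \<phi> \<gamma> V \<and> AssumptionV \<sigma> I \<phi> \<gamma> V"
proof
  interpret piecewise_C1_domain I \<phi> \<gamma> V
    using dom by unfold_locales (auto simp: polyhedral_refl_def)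
  have "bounded (GG I \<phi>) \<or> polyhedral_refl I \<phi> \<gamma>" using dom by blast
  then have "barriers_along \<epsilon> y" if "0 < \<epsilon>" "range y \<subseteq> closed_domain" for \<epsilon> y
    using A2 that by (rule barriers_along_closed_domain)
  then have "\<exists>r>0. \<forall>y\<in>closed_domain. \<exists>h. bump_at \<epsilon> r y h" if "0 < \<epsilon>" for \<epsilon>
    using that by (rule uniform_bumps_if_barriers_along)
  then show "AssumptionTF b \<sigma> I \<phi> \<gamma> V"
    using b_bdd \<sigma>_bdd by (rule AssumptionTF_if_uniform_bumps)
  show "AssumptionV \<sigma> I \<phi> \<gamma> V" by (rule AssumptionV_if_Assumption2'[OF A2])
qed

end
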